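(* Let $(\mathfrak{E},h)=(E,\Phi,h)$ be a hermitian Higgs bundle over a compact Kähler manifold $M$ and $\mathcal{D}_h=D_h+\Phi+\bar\Phi_h$ its Hitchin-Simpson connection. Let $\mathfrak{E}'=(E',\Phi|_{E'})\subset\mathfrak{E}$ be a $\mathcal{D}_h$-invariant and $\bar\Phi_h$-invariant Higgs subbundle and let $\mathfrak{E}''=(E'',\Phi|_{E''})$ be the $C^\infty$ Higgs orthogonal complement of $\mathfrak{E}'$ with respect to $h$. Then $\mathfrak{E}''\subset\mathfrak{E}$ is also a $\mathcal{D}_h$-invariant Higgs subbundle and $\mathfrak{E}=\mathfrak{E}'\oplus\mathfrak{E}''$ is a Higgs orthogonal decomposition.
   Context: $M$ is a compact Kähler manifold with holomorphic cotangent bundle $\Omega^{1,0}$ and complex conjugate bundle $\Omega^{0,1}$. For a $C^\infty$ complex vector bundle $V$ over $M$, $A^s(V)$ (resp. $A^{p,q}(V)$) is the space of $C^\infty$ complex $s$-forms (resp. $(p,q)$-forms) on $M$ with values in $V$. A Higgs bundle $\mathfrak{E}=(E,\Phi)$ over $M$ is a holomorphic vector bundle $E$ with a holomorphic $\Phi\in A^{1,0}(\mathrm{End}\,E)$ (the Higgs field) satisfying $\Phi\wedge\Phi=0$. A hermitian Higgs bundle $(\mathfrak{E},h)=(E,\Phi,h)$ is a Higgs bundle with a hermitian metric $h$ in $E$. $D_h$ is the Chern connection of $(E,h)$ and $\bar\Phi_h\in A^{0,1}(\mathrm{End}\,E)$ is the hermitian conjugate of $\Phi$ with respect to $h$, i.e.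 $h(\bar\Phi_h\xi,\eta)=h(\xi,\Phi\eta)$ for all sections $\xi,\eta$ of $E$. A Higgs subbundle of $\mathfrak{E}$ is a holomorphic subbundle $F\subset E$ that is $\Phi$-invariant ($\Phi(F)\subset F\otimes\Omega^{1,0}$), regarded as the Higgs bundle $(F,\Phi|_F)$. It is $\mathcal{D}_h$-invariant if $\mathcal{D}_h$ maps $A^0(F)$ into $A^1(F)$, and $\bar\Phi_h$-invariant if $\bar\Phi_h(F)\subset F\otimes\Omega^{0,1}$. The $C^\infty$ Higgs orthogonal complement of a Higgs subbundle $\mathfrak{E}'=(E',\Phi|_{E'})$ with respect to $h$ is the pair $\mathfrak{E}''=(E'',\Phi|_{E''})$, where $E''\subset E$ is the orthogonal complement of $E'$ with respect to $h$; a priori $E''$ is only a $C^\infty$ complex subbundle of $E$. A Higgs orthogonal decomposition $\mathfrak{E}=\mathfrak{E}'\oplus\mathfrak{E}''$ is a holomorphic direct sum decomposition $E=E'\oplus E''$, orthogonal with respect to $h$, in which both summands are Higgs subbundles of $\mathfrak{E}$. *)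

theory Defs
  imports "HOL-Analysis.Analysis"
begin

section \<open>Smooth and holomorphic functions of several complex variables\<close>

text \<open>Both predicates are meant for open sets \<open>S\<close> only.\<close>

primrec Ck_on :: "nat \<Rightarrow> 'a::real_normed_vector set \<Rightarrow> ('a \<Rightarrow> 'b::real_normed_vector) \<Rightarrow> bool" where
  "Ck_on 0 S f \<longleftrightarrow> continuous_on S f"
| "Ck_on (Suc k) S f \<longleftrightarrow> (\<forall>z\<in>S. f differentiable (at z)) \<and>
      (\<forall>u. Ck_on k S (\<lambda>z. frechet_derivative f (at z) u))"

definition smooth_on :: "'a::real_normed_vector set \<Rightarrow> ('a \<Rightarrow> 'b::real_normed_vector) \<Rightarrow> bool" where
  "smooth_on S f \<longleftrightarrow> (\<forall>k. Ck_on k S f)"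

text \<open>A holomorphic function is a smooth function whose differential is complex linear
  (equivalently, which is annihilated by the Cauchy-Riemann operators).\<close>

definition holo_on :: "(complex^'n) set \<Rightarrow> (complex^'n \<Rightarrow> complex) \<Rightarrow> bool" where
  "holo_on S f \<longleftrightarrow> smooth_on S f \<and>
     (\<forall>z\<in>S. \<forall>u. frechet_derivative f (at z) (\<i> *s u) = \<i> * frechet_derivative f (at z) u)"


section \<open>Complex manifolds\<close>

text \<open>The points of \<open>M\<close> are the elements of a Hausdorff type \<open>'m\<close>; a chart is a pair of an open
  domain and a coordinate map, whose values outside the domain are irrelevant.\<close>

type_synonym ('m, 'n) chart = "'m set \<times> ('m \<Rightarrow> complex^'n)"

definition chart :: "('m::topological_space, 'n::finite) chart \<Rightarrow> bool" where
  "chart = (\<lambda>(U, \<phi>). open U \<and> open (\<phi> ` U) \<and> homeomorphism U (\<phi> ` U) \<phi> (inv_into U \<phi>))"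

definition complex_atlas :: "('m::topological_space, 'n::finite) chart set \<Rightarrow> bool" where
  "complex_atlas A \<longleftrightarrow> (\<forall>c\<in>A. chart c) \<and> (\<Union>c\<in>A. fst c) = UNIV \<and>
     (\<forall>(U, \<phi>)\<in>A. \<forall>(V, \<phi>')\<in>A. \<forall>k. holo_on (\<phi> ` (U \<inter> V)) (\<lambda>z. \<phi>' (inv_into U \<phi> z) $ k))"

definition smooth_map ::
    "('m, 'n::finite) chart set \<Rightarrow> 'm set \<Rightarrow> ('m \<Rightarrow> 'b::real_normed_vector) \<Rightarrow> bool" where
  "smooth_map A W f \<longleftrightarrow> (\<forall>(U, \<phi>)\<in>A. smooth_on (\<phi> ` (U \<inter> W)) (f \<circ> inv_into U \<phi>))"

definition holo_map :: "('m, 'n::finite) chart set \<Rightarrow> 'm set \<Rightarrow> ('m \<Rightarrow> complex) \<Rightarrow> bool" where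
  "holo_map A W f \<longleftrightarrow> (\<forall>(U, \<phi>)\<in>A. holo_on (\<phi> ` (U \<inter> W)) (f \<circ> inv_into U \<phi>))"

text \<open>A real tangent vector at \<open>x\<close> is the directional derivative operator that it induces on the
  complex valued functions that are smooth near \<open>x\<close> (extended by \<open>0\<close> to all other functions).
  In the chart \<open>c\<close> the vector with coordinates \<open>u \<in> \<complex>\<^sup>n = \<real>\<^sup>2\<^sup>n\<close> is \<open>tvec A c x u\<close>; the
  complex structure of the tangent space sends it to \<open>tvec A c x (\<i> *s u)\<close>. The differential of
  \<open>f\<close> at \<open>x\<close> is \<open>\<lambda>v. v f\<close>.\<close>

type_synonym 'm tangent = "('m \<Rightarrow> complex) \<Rightarrow> complex"

definition tvec ::
    "('m::topological_space, 'n::finite) chart set \<Rightarrow> ('m, 'n) chart \<Rightarrow> 'm \<Rightarrow> complex^'n \<Rightarrow> 'm tangent" where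
  "tvec A c x u = (\<lambda>f. if \<exists>W. open W \<and> x \<in> W \<and> smooth_map A W f
       then frechet_derivative (f \<circ> inv_into (fst c) (snd c)) (at (snd c x)) u else 0)"

definition tangent_space ::
    "('m::topological_space, 'n::finite) chart set \<Rightarrow> 'm \<Rightarrow> 'm tangent set" where
  "tangent_space A x = {tvec A c x u | c u. c \<in> A \<and> x \<in> fst c}"


section \<open>Compact Kaehler manifolds\<close>

type_synonym 'm form2 = "'m \<Rightarrow> 'm tangent \<Rightarrow> 'm tangent \<Rightarrow> real"

definition smooth_2form ::
    "('m::topological_space, 'n::finite) chart set \<Rightarrow> 'm form2 \<Rightarrow> bool" where
  "smooth_2form A \<omega> \<longleftrightarrow> (\<forall>c\<in>A.
     (\<forall>x\<in>fst c. bilinear (\<lambda>u w. \<omega> x (tvec A c x u) (tvec A c x w)) \<and>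
                (\<forall>u. \<omega> x (tvec A c x u) (tvec A c x u) = 0)) \<and>
     (\<forall>u w. smooth_map A (fst c) (\<lambda>x. \<omega> x (tvec A c x u) (tvec A c x w))))"

text \<open>Exterior derivative in the chart \<open>c\<close>, evaluated on constant coordinate vector fields (whose
  brackets vanish).\<close>

definition ext_deriv2 ::
    "('m::topological_space, 'n::finite) chart set \<Rightarrow> ('m, 'n) chart \<Rightarrow> 'm form2 \<Rightarrow> 'm
      \<Rightarrow> complex^'n \<Rightarrow> complex^'n \<Rightarrow> complex^'n \<Rightarrow> real" where
  "ext_deriv2 A c \<omega> x u v w =
    (let coeff = (\<lambda>a b z. let y = inv_into (fst c) (snd c) z in \<omega> y (tvec A c y a) (tvec A c y b));
         d = (\<lambda>g. frechet_derivative g (at (snd c x)))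
     in d (coeff v w) u - d (coeff u w) v + d (coeff u v) w)"

definition kaehler_form ::
    "('m::topological_space, 'n::finite) chart set \<Rightarrow> 'm form2 \<Rightarrow> bool" where
  "kaehler_form A \<omega> \<longleftrightarrow> smooth_2form A \<omega> \<and>
     (\<forall>c\<in>A. \<forall>x\<in>fst c.
        (\<forall>u w. \<omega> x (tvec A c x (\<i> *s u)) (tvec A c x (\<i> *s w)) = \<omega> x (tvec A c x u) (tvec A c x w)) \<and>
        (\<forall>u. u \<noteq> 0 \<longrightarrow> \<omega> x (tvec A c x u) (tvec A c x (\<i> *s u)) > 0) \<and>
        (\<forall>u v w. ext_deriv2 A c \<omega> x u v w = 0))"

definition compact_kaehler_manifold ::
    "('m::t2_space, 'n::finite) chart set \<Rightarrow> 'm form2 \<Rightarrow> bool" where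
  "compact_kaehler_manifold A \<omega> \<longleftrightarrow>
     compact (UNIV :: 'm set) \<and> complex_atlas A \<and> kaehler_form A \<omega>"


section \<open>Holomorphic vector bundles\<close>

text \<open>The fibre \<open>E\<^sub>x\<close> of a bundle of rank \<open>r\<close> is, as a bare complex vector space, written as
  \<open>\<complex>\<^sup>r\<close>. These identifications are chosen independently at each point and carry no continuity,
  so the bundle need not be trivial: its topology and its holomorphic structure consist in the set
  \<open>B\<close> of local trivialisations \<open>(W, \<psi>)\<close>, where \<open>\<psi> x\<close> is a linear isomorphism from \<open>E\<^sub>x\<close> to the
  model fibre for every \<open>x \<in> W\<close> and the transition functions are holomorphic. Accordingly
  \<open>End E\<^sub>x\<close> is a space of matrices.\<close>

type_synonym ('m, 'r) triv = "'m set \<times> ('m \<Rightarrow> complex^'r^'r)"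

definition holomorphic_vector_bundle ::
    "('m::topological_space, 'n::finite) chart set \<Rightarrow> ('m, 'r::finite) triv set \<Rightarrow> bool" where
  "holomorphic_vector_bundle A B \<longleftrightarrow>
     (\<forall>(W, \<psi>)\<in>B. open W \<and> (\<forall>x\<in>W. invertible (\<psi> x))) \<and> (\<Union>\<tau>\<in>B. fst \<tau>) = UNIV \<and>
     (\<forall>(W, \<psi>)\<in>B. \<forall>(W', \<psi>')\<in>B. \<forall>j k.
        holo_map A (W \<inter> W') (\<lambda>x. (\<psi>' x ** matrix_inv (\<psi> x)) $ j $ k))"

definition holo_section ::
    "('m, 'n::finite) chart set \<Rightarrow> ('m, 'r::finite) triv set \<Rightarrow> 'm set \<Rightarrow> ('m \<Rightarrow> complex^'r) \<Rightarrow> bool" where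
  "holo_section A B W s \<longleftrightarrow> (\<forall>(W', \<psi>)\<in>B. \<forall>j. holo_map A (W \<inter> W') (\<lambda>x. (\<psi> x *v s x) $ j))"

text \<open>A family of subsets \<open>F x\<close> of the fibres is a holomorphic subbundle if it is spanned
  near every point by a holomorphic frame.\<close>

definition holomorphic_subbundle ::
    "('m::topological_space, 'n::finite) chart set \<Rightarrow> ('m, 'r::finite) triv set
      \<Rightarrow> ('m \<Rightarrow> (complex^'r) set) \<Rightarrow> bool" where
  "holomorphic_subbundle A B F \<longleftrightarrow>
     (\<forall>x. \<exists>W (k::nat) e. open W \<and> x \<in> W \<and> (\<forall>i<k. holo_section A B W (e i)) \<and>
        (\<forall>y\<in>W. inj_on (\<lambda>i. e i y) {..<k} \<and> vec.independent ((\<lambda>i. e i y) ` {..<k}) \<and>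
                vec.span ((\<lambda>i. e i y) ` {..<k}) = F y))"

text \<open>\<open>A0 A B F\<close> and \<open>A1 A B F\<close> are \<open>A\<^sup>0(F)\<close> and \<open>A\<^sup>1(F)\<close> for a subbundle \<open>F\<close> of \<open>E\<close>; the bundle
  \<open>E\<close> itself is \<open>\<lambda>_. UNIV\<close>. A 1-form \<open>\<alpha>\<close> only matters on tangent vectors: \<open>\<alpha> x v\<close> is
  unconstrained for \<open>v\<close> outside \<open>tangent_space A x\<close>.\<close>

definition A0 ::
    "('m, 'n::finite) chart set \<Rightarrow> ('m, 'r::finite) triv set \<Rightarrow> ('m \<Rightarrow> (complex^'r) set)
      \<Rightarrow> ('m \<Rightarrow> complex^'r) set" where
  "A0 A B F = {s. (\<forall>x. s x \<in> F x) \<and> (\<forall>(W, \<psi>)\<in>B. smooth_map A W (\<lambda>x. \<psi> x *v s x))}"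

definition A1 ::
    "('m::topological_space, 'n::finite) chart set \<Rightarrow> ('m, 'r::finite) triv set
      \<Rightarrow> ('m \<Rightarrow> (complex^'r) set) \<Rightarrow> ('m \<Rightarrow> 'm tangent \<Rightarrow> complex^'r) set" where
  "A1 A B F = {\<alpha>. (\<forall>x. \<forall>v\<in>tangent_space A x. \<alpha> x v \<in> F x) \<and>
     (\<forall>c\<in>A. \<forall>x\<in>fst c. linear (\<lambda>u. \<alpha> x (tvec A c x u))) \<and>
     (\<forall>c\<in>A. \<forall>(W, \<psi>)\<in>B. \<forall>u. smooth_map A (fst c \<inter> W) (\<lambda>x. \<psi> x *v \<alpha> x (tvec A c x u)))}"

type_synonym ('m, 'r) end_form = "'m \<Rightarrow> 'm tangent \<Rightarrow> complex^'r^'r"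

definition A1_End ::
    "('m::topological_space, 'n::finite) chart set \<Rightarrow> ('m, 'r::finite) triv set
      \<Rightarrow> ('m, 'r) end_form set" where
  "A1_End A B = {\<Theta>.
     (\<forall>c\<in>A. \<forall>x\<in>fst c. linear (\<lambda>u. \<Theta> x (tvec A c x u))) \<and>
     (\<forall>c\<in>A. \<forall>(W, \<psi>)\<in>B. \<forall>u.
        smooth_map A (fst c \<inter> W) (\<lambda>x. \<psi> x ** \<Theta> x (tvec A c x u) ** matrix_inv (\<psi> x)))}"

definition A10_End ::
    "('m::topological_space, 'n::finite) chart set \<Rightarrow> ('m, 'r::finite) triv set
      \<Rightarrow> ('m, 'r) end_form set" where
  "A10_End A B = {\<Theta> \<in> A1_End A B. \<forall>c\<in>A. \<forall>x\<in>fst c. \<forall>u e.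
     \<Theta> x (tvec A c x (\<i> *s u)) *v e = \<i> *s (\<Theta> x (tvec A c x u) *v e)}"

definition A01_End ::
    "('m::topological_space, 'n::finite) chart set \<Rightarrow> ('m, 'r::finite) triv set
      \<Rightarrow> ('m, 'r) end_form set" where
  "A01_End A B = {\<Theta> \<in> A1_End A B. \<forall>c\<in>A. \<forall>x\<in>fst c. \<forall>u e.
     \<Theta> x (tvec A c x (\<i> *s u)) *v e = - (\<i> *s (\<Theta> x (tvec A c x u) *v e))}"

text \<open>For a form of type (1,0) the coefficients with respect to the coordinate differentials
  \<open>dz\<^sub>k\<close> are its values on the coordinate vectors, which is how holomorphy is expressed.\<close>

definition holomorphic_End_form ::
    "('m::topological_space, 'n::finite) chart set \<Rightarrow> ('m, 'r::finite) triv set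
      \<Rightarrow> ('m, 'r) end_form \<Rightarrow> bool" where
  "holomorphic_End_form A B \<Theta> \<longleftrightarrow> \<Theta> \<in> A10_End A B \<and>
     (\<forall>c\<in>A. \<forall>(W, \<psi>)\<in>B. \<forall>u j k. holo_map A (fst c \<inter> W)
        (\<lambda>x. (\<psi> x ** \<Theta> x (tvec A c x u) ** matrix_inv (\<psi> x)) $ j $ k))"


section \<open>Hermitian Higgs bundles\<close>

definition wedge_End ::
    "('m, 'r::finite) end_form \<Rightarrow> ('m, 'r) end_form \<Rightarrow> 'm \<Rightarrow> 'm tangent \<Rightarrow> 'm tangent \<Rightarrow> complex^'r^'r" where
  "wedge_End \<Theta> \<Xi> x v w = \<Theta> x v ** \<Xi> x w - \<Theta> x w ** \<Xi> x v"

definition higgs_bundle ::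
    "('m::topological_space, 'n::finite) chart set \<Rightarrow> ('m, 'r::finite) triv set
      \<Rightarrow> ('m, 'r) end_form \<Rightarrow> bool" where
  "higgs_bundle A B \<Phi> \<longleftrightarrow> holomorphic_vector_bundle A B \<and> holomorphic_End_form A B \<Phi> \<and>
     (\<forall>x. \<forall>v\<in>tangent_space A x. \<forall>w\<in>tangent_space A x. wedge_End \<Phi> \<Phi> x v w = 0)"

text \<open>Hermitian forms are complex linear in the first argument.\<close>

type_synonym ('m, 'r) herm = "'m \<Rightarrow> complex^'r \<Rightarrow> complex^'r \<Rightarrow> complex"

definition hermitian_metric ::
    "('m, 'n::finite) chart set \<Rightarrow> ('m, 'r::finite) triv set \<Rightarrow> ('m, 'r) herm \<Rightarrow> bool" where
  "hermitian_metric A B h \<longleftrightarrow>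
     (\<forall>x a u u' w. h x (a *s u + u') w = a * h x u w + h x u' w) \<and>
     (\<forall>x u w. h x w u = cnj (h x u w)) \<and>
     (\<forall>x u. u \<noteq> 0 \<longrightarrow> Re (h x u u) > 0) \<and>
     (\<forall>(W, \<psi>)\<in>B. \<forall>a b.
        smooth_map A W (\<lambda>x. h x (matrix_inv (\<psi> x) *v a) (matrix_inv (\<psi> x) *v b)))"

definition hermitian_higgs_bundle ::
    "('m::topological_space, 'n::finite) chart set \<Rightarrow> ('m, 'r::finite) triv set
      \<Rightarrow> ('m, 'r) end_form \<Rightarrow> ('m, 'r) herm \<Rightarrow> bool" where
  "hermitian_higgs_bundle A B \<Phi> h \<longleftrightarrow> higgs_bundle A B \<Phi> \<and> hermitian_metric A B h"

text \<open>The equation is imposed on real tangent vectors \<open>v\<close>; since \<open>h\<close> is conjugate linear in its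
  second argument, \<open>v \<mapsto> h (\<xi>, \<Phi>(v) \<eta>)\<close> is then of type (0,1).\<close>

definition hermitian_conjugate ::
    "('m::topological_space, 'n::finite) chart set \<Rightarrow> ('m, 'r::finite) triv set \<Rightarrow> ('m, 'r) herm
      \<Rightarrow> ('m, 'r) end_form \<Rightarrow> ('m, 'r) end_form \<Rightarrow> bool" where
  "hermitian_conjugate A B h \<Phi> \<Phi>b \<longleftrightarrow> \<Phi>b \<in> A01_End A B \<and>
     (\<forall>x. \<forall>v\<in>tangent_space A x. \<forall>\<xi> \<eta>. h x (\<Phi>b x v *v \<xi>) \<eta> = h x \<xi> (\<Phi> x v *v \<eta>))"


section \<open>Chern and Hitchin-Simpson connections\<close>

type_synonym ('m, 'r) conn = "('m \<Rightarrow> complex^'r) \<Rightarrow> 'm \<Rightarrow> 'm tangent \<Rightarrow> complex^'r"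

text \<open>\<open>(0,1)\<close>-part of a real linear form in chart coordinates.\<close>

definition part01 :: "(complex^'n \<Rightarrow> complex^'r) \<Rightarrow> complex^'n \<Rightarrow> complex^'r" where
  "part01 \<alpha> u = (1/2) *s (\<alpha> u + \<i> *s \<alpha> (\<i> *s u))"

text \<open>The Cauchy-Riemann operator of \<open>E\<close>: it differentiates the components of \<open>s\<close> in a
  holomorphic trivialisation.\<close>

definition dbar ::
    "('m::topological_space, 'n::finite) chart set \<Rightarrow> ('m, 'n) chart \<Rightarrow> ('m, 'r::finite) triv
      \<Rightarrow> ('m \<Rightarrow> complex^'r) \<Rightarrow> 'm \<Rightarrow> complex^'n \<Rightarrow> complex^'r" where
  "dbar A c \<tau> s x u = matrix_inv (snd \<tau> x) *v
     part01 (\<lambda>u. \<chi> j. tvec A c x u (\<lambda>y. (snd \<tau> y *v s y) $ j)) u"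

definition connection ::
    "('m::topological_space, 'n::finite) chart set \<Rightarrow> ('m, 'r::finite) triv set
      \<Rightarrow> ('m, 'r) conn \<Rightarrow> bool" where
  "connection A B D \<longleftrightarrow>
     (\<forall>s\<in>A0 A B (\<lambda>_. UNIV). D s \<in> A1 A B (\<lambda>_. UNIV)) \<and>
     (\<forall>s\<in>A0 A B (\<lambda>_. UNIV). \<forall>t\<in>A0 A B (\<lambda>_. UNIV). \<forall>x. \<forall>v\<in>tangent_space A x.
        D (\<lambda>y. s y + t y) x v = D s x v + D t x v) \<and>
     (\<forall>f. \<forall>s\<in>A0 A B (\<lambda>_. UNIV). smooth_map A UNIV f \<longrightarrow> (\<forall>x. \<forall>v\<in>tangent_space A x.
        D (\<lambda>y. f y *s s y) x v = v f *s s x + f x *s D s x v))"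

definition metric_connection ::
    "('m::topological_space, 'n::finite) chart set \<Rightarrow> ('m, 'r::finite) triv set \<Rightarrow> ('m, 'r) herm
      \<Rightarrow> ('m, 'r) conn \<Rightarrow> bool" where
  "metric_connection A B h D \<longleftrightarrow> connection A B D \<and>
     (\<forall>s\<in>A0 A B (\<lambda>_. UNIV). \<forall>t\<in>A0 A B (\<lambda>_. UNIV). \<forall>x. \<forall>v\<in>tangent_space A x.
        v (\<lambda>y. h y (s y) (t y)) = h x (D s x v) (t x) + h x (s x) (D t x v))"

definition chern_connection ::
    "('m::topological_space, 'n::finite) chart set \<Rightarrow> ('m, 'r::finite) triv set \<Rightarrow> ('m, 'r) herm
      \<Rightarrow> ('m, 'r) conn \<Rightarrow> bool" where
  "chern_connection A B h D \<longleftrightarrow> metric_connection A B h D \<and>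
     (\<forall>s\<in>A0 A B (\<lambda>_. UNIV). \<forall>c\<in>A. \<forall>\<tau>\<in>B. \<forall>x\<in>fst c \<inter> fst \<tau>. \<forall>u.
        part01 (\<lambda>u. D s x (tvec A c x u)) u = dbar A c \<tau> s x u)"

definition hitchin_simpson ::
    "('m, 'r::finite) conn \<Rightarrow> ('m, 'r) end_form \<Rightarrow> ('m, 'r) end_form \<Rightarrow> ('m, 'r) conn" where
  "hitchin_simpson D \<Phi> \<Phi>b = (\<lambda>s x v. D s x v + \<Phi> x v *v s x + \<Phi>b x v *v s x)"


section \<open>Higgs subbundles and orthogonal decompositions\<close>

definition form_invariant ::
    "('m::topological_space, 'n::finite) chart set \<Rightarrow> ('m, 'r::finite) end_form
      \<Rightarrow> ('m \<Rightarrow> (complex^'r) set) \<Rightarrow> bool" where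
  "form_invariant A \<Theta> F \<longleftrightarrow> (\<forall>x. \<forall>v\<in>tangent_space A x. \<forall>e\<in>F x. \<Theta> x v *v e \<in> F x)"

definition connection_invariant ::
    "('m::topological_space, 'n::finite) chart set \<Rightarrow> ('m, 'r::finite) triv set \<Rightarrow> ('m, 'r) conn
      \<Rightarrow> ('m \<Rightarrow> (complex^'r) set) \<Rightarrow> bool" where
  "connection_invariant A B \<D> F \<longleftrightarrow> (\<forall>s\<in>A0 A B F. \<D> s \<in> A1 A B F)"

definition higgs_subbundle ::
    "('m::topological_space, 'n::finite) chart set \<Rightarrow> ('m, 'r::finite) triv set
      \<Rightarrow> ('m, 'r) end_form \<Rightarrow> ('m \<Rightarrow> (complex^'r) set) \<Rightarrow> bool" where
  "higgs_subbundle A B \<Phi> F \<longleftrightarrow> holomorphic_subbundle A B F \<and> form_invariant A \<Phi> F"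

definition orth_complement ::
    "('m, 'r::finite) herm \<Rightarrow> ('m \<Rightarrow> (complex^'r) set) \<Rightarrow> 'm \<Rightarrow> (complex^'r) set" where
  "orth_complement h F x = {w. \<forall>u\<in>F x. h x u w = 0}"

definition holomorphic_direct_sum ::
    "('m::topological_space, 'n::finite) chart set \<Rightarrow> ('m, 'r::finite) triv set
      \<Rightarrow> ('m \<Rightarrow> (complex^'r) set) \<Rightarrow> ('m \<Rightarrow> (complex^'r) set) \<Rightarrow> bool" where
  "holomorphic_direct_sum A B F G \<longleftrightarrow>
     holomorphic_subbundle A B F \<and> holomorphic_subbundle A B G \<and>
     (\<forall>x e. \<exists>!p. p \<in> F x \<times> G x \<and> e = fst p + snd p)"

definition higgs_orthogonal_decomposition ::
    "('m::topological_space, 'n::finite) chart set \<Rightarrow> ('m, 'r::finite) triv set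
      \<Rightarrow> ('m, 'r) end_form \<Rightarrow> ('m, 'r) herm
      \<Rightarrow> ('m \<Rightarrow> (complex^'r) set) \<Rightarrow> ('m \<Rightarrow> (complex^'r) set) \<Rightarrow> bool" where
  "higgs_orthogonal_decomposition A B \<Phi> h F G \<longleftrightarrow> holomorphic_direct_sum A B F G \<and>
     (\<forall>x. \<forall>u\<in>F x. \<forall>w\<in>G x. h x u w = 0) \<and>
     higgs_subbundle A B \<Phi> F \<and> higgs_subbundle A B \<Phi> G"

end

theory Submission
  imports Defs
begin

text \<open>
  The idea is that orthogonal projection along a parallel subbundle is itself parallel, hence
  compatible with the Cauchy-Riemann operator.

  Subtracting the two Higgs terms from the Hitchin-Simpson connection shows that the Chern
  connection \<open>D\<close> preserves \<open>E'\<close>. Since \<open>D\<close> is a metric connection, it also preserves \<open>E''\<close>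
  (lemma \<open>F_orth_parallel\<close>): differentiating \<open>h(s, t) = 0\<close> for \<open>s\<close> in \<open>E'\<close> and \<open>t\<close> in \<open>E''\<close>
  leaves \<open>h(s, D t) = 0\<close>. If the (0,1)-part of \<open>D s\<close> vanishes, then so do its components in \<open>E'\<close>
  and \<open>E''\<close>, so the projection of a holomorphic section to \<open>E''\<close> is holomorphic (lemma
  \<open>proj_part01_zero\<close>). Projecting the sections that are constant in a holomorphic trivialisation
  and selecting suitable ones gives holomorphic frames of \<open>E''\<close> (theorem
  \<open>holomorphic_orth_complement\<close>). The invariance of \<open>E''\<close> under \<open>\<Phi>\<close> and its adjoint is pointwise
  linear algebra: the complement of a subspace that is invariant under an operator is invariant
  under the adjoint operator.

  The analysis behind this is the smoothness of the projection, obtained from a Gram-Schmidt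
  process on a local frame (lemma \<open>smooth_orthogonalization\<close>), and the existence of smooth bump
  functions (lemma \<open>smooth_bump\<close>). The latter are needed because \<open>D\<close> acts on global sections, so
  that local sections have to be extended to all of \<open>M\<close>.
\<close>

section \<open>Calculus of smooth functions on open sets\<close>

lemma Ck_on_subset: "Ck_on k S f \<Longrightarrow> T \<subseteq> S \<Longrightarrow> Ck_on k T f"
  by (induction k arbitrary: f) (auto intro: continuous_on_subset)

lemma Ck_on_local:
  assumes "\<And>z. z \<in> S \<Longrightarrow> \<exists>T. open T \<and> z \<in> T \<and> Ck_on k T f"
  shows "Ck_on k S f"
  using assms
proof (induction k arbitrary: f)
  case 0
  show ?case
    unfolding Ck_on.simps
  proof (rule continuous_at_imp_continuous_on, rule ballI)
    fix z assume "z \<in> S"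
    then obtain T where "open T" "z \<in> T" "continuous_on T f"
      using 0 by auto
    then show "isCont f z"
      by (simp add: continuous_on_eq_continuous_at)
  qed
next
  case (Suc k)
  have "f differentiable (at z)" if "z \<in> S" for z
    using Suc.prems[OF that] by auto
  moreover have "Ck_on k S (\<lambda>z. frechet_derivative f (at z) u)" for u
  proof (rule Suc.IH)
    fix z assume "z \<in> S"
    from Suc.prems[OF this]
    show "\<exists>T. open T \<and> z \<in> T \<and> Ck_on k T (\<lambda>z. frechet_derivative f (at z) u)"
      by auto
  qed
  ultimately show ?case by simp
qed

lemma Ck_on_cong:
  assumes "open S" "\<And>z. z \<in> S \<Longrightarrow> f z = g z" "Ck_on k S f"
  shows "Ck_on k S g"
  using assms(2,3)
proof (induction k arbitrary: f g)
  case 0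
  then show ?case by (simp cong: continuous_on_cong)
next
  case (Suc k)
  have der: "(g has_derivative frechet_derivative f (at z)) (at z)" if "z \<in> S" for z
    by (rule has_derivative_transform_within_open[OF _ assms(1) that, of f])
      (use Suc.prems that in \<open>auto simp: frechet_derivative_works\<close>)
  have eq: "frechet_derivative f (at z) = frechet_derivative g (at z)" if "z \<in> S" for z
    using frechet_derivative_at[OF der[OF that]] .
  have "Ck_on k S (\<lambda>z. frechet_derivative g (at z) u)" for u
    by (rule Suc.IH[of "\<lambda>z. frechet_derivative f (at z) u"]) (use Suc.prems eq in auto)
  then show ?case
    using der by (auto simp: differentiable_def)
qed

lemma Ck_on_SucI:
  assumes "open S" "\<And>z. z \<in> S \<Longrightarrow> (f has_derivative f' z) (at z)"
    and "\<And>u. Ck_on k S (\<lambda>z. f' z u)"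
  shows "Ck_on (Suc k) S f"
proof -
  have "f' z = frechet_derivative f (at z)" if "z \<in> S" for z
    using frechet_derivative_at[OF assms(2)[OF that]] .
  then have "Ck_on k S (\<lambda>z. frechet_derivative f (at z) u)" for u
    using Ck_on_cong[OF assms(1) _ assms(3), where g = "\<lambda>z. frechet_derivative f (at z) u"] by simp
  then show ?thesis
    using assms(2) by (auto simp: differentiable_def)
qed

lemma Ck_on_SucD:
  assumes "Ck_on (Suc k) S f"
  shows "\<And>z. z \<in> S \<Longrightarrow> (f has_derivative frechet_derivative f (at z)) (at z)"
    and "\<And>u. Ck_on k S (\<lambda>z. frechet_derivative f (at z) u)"
  using assms by (auto simp: frechet_derivative_works)

lemma Ck_on_lower: "Ck_on (Suc k) S f \<Longrightarrow> Ck_on k S f"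
proof (induction k arbitrary: f)
  case 0
  then show ?case
    by (auto intro!: continuous_at_imp_continuous_on differentiable_imp_continuous_within)
next
  case (Suc k)
  then show ?case
    using Suc.IH by (metis Ck_on.simps(2))
qed

lemma Ck_on_const: "Ck_on k S (\<lambda>z. c)"
  by (induction k arbitrary: c) auto

lemma Ck_on_bounded_linear:
  assumes "bounded_linear L" "open S" "Ck_on k S f"
  shows "Ck_on k S (\<lambda>z. L (f z))"
  using assms(3)
proof (induction k arbitrary: f)
  case 0
  then show ?case
    using bounded_linear.continuous_on[OF assms(1)] by simp
next
  case (Suc k)
  note D = Ck_on_SucD[OF Suc.prems]
  show ?case
    by (rule Ck_on_SucI[OF assms(2) bounded_linear.has_derivative[OF assms(1) D(1)]])
      (auto intro: Suc.IH D(2))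
qed

lemma Ck_on_add:
  assumes "open S" "Ck_on k S f" "Ck_on k S g"
  shows "Ck_on k S (\<lambda>z. f z + g z)"
  using assms(2,3)
proof (induction k arbitrary: f g)
  case 0
  then show ?case by (auto intro: continuous_intros)
next
  case (Suc k)
  note D = Ck_on_SucD[OF Suc.prems(1)] and D' = Ck_on_SucD[OF Suc.prems(2)]
  show ?case
    by (rule Ck_on_SucI[OF assms(1) has_derivative_add[OF D(1) D'(1)]])
      (auto intro: Suc.IH D(2) D'(2))
qed

lemma Ck_on_bilinear:
  assumes b: "bounded_bilinear b" and S: "open S" and "Ck_on k S f" "Ck_on k S g"
  shows "Ck_on k S (\<lambda>z. b (f z) (g z))"
  using assms(3,4)
proof (induction k arbitrary: f g)
  case 0
  then show ?case
    using bounded_bilinear.continuous_on[OF b] by simp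
next
  case (Suc k)
  note D = Ck_on_SucD[OF Suc.prems(1)] and D' = Ck_on_SucD[OF Suc.prems(2)]
  show ?case
    by (rule Ck_on_SucI[OF S bounded_bilinear.FDERIV[OF b D(1) D'(1)]], assumption, assumption)
      (intro Ck_on_add[OF S] Suc.IH D(2) D'(2) Suc.prems[THEN Ck_on_lower])
qed

lemma Ck_on_sum:
  assumes "open S" "\<And>i. i \<in> I \<Longrightarrow> Ck_on k S (f i)"
  shows "Ck_on k S (\<lambda>z. \<Sum>i\<in>I. f i z)"
  using assms(2)
  by (induction I rule: infinite_finite_induct) (auto intro: Ck_on_const Ck_on_add[OF assms(1)])

lemma Ck_on_vec:
  fixes f :: "'a::real_normed_vector \<Rightarrow> 'b::euclidean_space^'k"
  assumes S: "open S" and "\<And>j. Ck_on k S (\<lambda>z. f z $ j)"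
  shows "Ck_on k S f"
proof -
  have "bounded_linear (axis j :: 'b \<Rightarrow> 'b^'k)" for j
    by (rule linear_conv_bounded_linear[THEN iffD1], rule linearI) (auto simp: vec_eq_iff axis_def)
  then have "Ck_on k S (\<lambda>z. \<Sum>j\<in>UNIV. axis j (f z $ j))"
    by (intro Ck_on_sum[OF S] Ck_on_bounded_linear[OF _ S assms(2)])
  moreover have "(\<Sum>j\<in>UNIV. axis j (f z $ j)) = f z" for z
    by (simp add: vec_eq_iff axis_def)
  ultimately show ?thesis by simp
qed

lemma Ck_on_inverse:
  fixes f :: "'a::real_normed_vector \<Rightarrow> 'b::real_normed_field"
  assumes S: "open S" and nz: "\<And>z. z \<in> S \<Longrightarrow> f z \<noteq> 0" and "Ck_on k S f"
  shows "Ck_on k S (\<lambda>z. inverse (f z))"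
  using assms(3)
proof (induction k)
  case 0
  then show ?case using nz by (auto intro: continuous_intros)
next
  case (Suc k)
  note D = Ck_on_SucD[OF Suc.prems]
  have I: "Ck_on k S (\<lambda>z. inverse (f z))"
    by (rule Suc.IH[OF Ck_on_lower[OF Suc.prems]])
  have d: "((\<lambda>z. inverse (f z)) has_derivative
      (\<lambda>u. - (inverse (f z) * frechet_derivative f (at z) u * inverse (f z)))) (at z)"
    if "z \<in> S" for z
    by (rule Deriv.has_derivative_inverse[OF nz[OF that] D(1)[OF that]])
  show ?case
    by (rule Ck_on_SucI[OF S d])
      (auto intro!: Ck_on_bounded_linear[OF bounded_linear_minus[OF bounded_linear_ident] S]
        Ck_on_bilinear[OF bounded_bilinear_mult S] I D(2))
qed

text \<open>The functions \<open>t\<^sup>-\<^sup>n exp (-1/t)\<close>, extended by \<open>0\<close> to \<open>t \<le> 0\<close>. Their linear span is closed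
  under differentiation, so all of them are smooth.\<close>

definition flat_exp :: "nat \<Rightarrow> real \<Rightarrow> real" where
  "flat_exp n t = (if t \<le> 0 then 0 else inverse t ^ n * exp (- inverse t))"

lemma flat_exp_tendsto_0: "(flat_exp n \<longlongrightarrow> 0) (at 0)"
proof -
  have "((\<lambda>t::real. inverse t ^ n / exp (inverse t)) \<longlongrightarrow> 0) (at_right 0)"
    by (rule filterlim_compose[OF tendsto_power_div_exp_0 filterlim_inverse_at_top_right])
  then have "(flat_exp n \<longlongrightarrow> 0) (at_right 0)"
    by (rule Lim_transform_eventually)
      (auto simp: flat_exp_def eventually_at_filter exp_minus field_simps)
  moreover have "(flat_exp n \<longlongrightarrow> 0) (at_left 0)"
    by (rule tendsto_eventually) (auto simp: flat_exp_def eventually_at_filter)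
  ultimately show ?thesis
    by (simp add: filterlim_split_at_real)
qed

lemma flat_exp_DERIV:
  "(flat_exp n has_real_derivative flat_exp (n + 2) t - of_nat n * flat_exp (n + 1) t) (at t)"
proof -
  consider "t < 0" | "t = 0" | "t > 0" by linarith
  then show ?thesis
  proof cases
    case 1
    have "((\<lambda>t. 0) has_real_derivative 0) (at t)" by simp
    then have "(flat_exp n has_real_derivative 0) (at t)"
      by (rule has_field_derivative_transform_within_open[of _ _ _ "{..<0}"])
        (use 1 in \<open>auto simp: flat_exp_def\<close>)
    then show ?thesis using 1 by (simp add: flat_exp_def)
  next
    case 2
    \<comment> \<open>The difference quotient at \<open>0\<close> is \<open>flat_exp (n + 1)\<close>.\<close>
    have "((\<lambda>s. flat_exp n s / s) \<longlongrightarrow> 0) (at 0)"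
      by (rule Lim_transform_eventually[OF flat_exp_tendsto_0[of "Suc n"]])
        (auto simp: flat_exp_def eventually_at_filter field_simps)
    then show ?thesis
      using 2 by (simp add: has_field_derivative_iff flat_exp_def)
  next
    case 3
    let ?i = "inverse t"
    have "((\<lambda>t. inverse t ^ n * exp (- inverse t)) has_real_derivative
        of_nat n * ?i ^ (n - 1) * (- (?i * ?i)) * exp (- ?i) + ?i ^ n * (exp (- ?i) * (?i * ?i))) (at t)"
      using 3 by (auto intro!: derivative_eq_intros)
    also have "of_nat n * ?i ^ (n - 1) * (- (?i * ?i)) * exp (- ?i) + ?i ^ n * (exp (- ?i) * (?i * ?i))
        = flat_exp (n + 2) t - of_nat n * flat_exp (n + 1) t"
      using 3 by (cases n) (auto simp: flat_exp_def algebra_simps)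
    finally have "((\<lambda>t. inverse t ^ n * exp (- inverse t)) has_real_derivative
        flat_exp (n + 2) t - of_nat n * flat_exp (n + 1) t) (at t)" .
    then show ?thesis
      by (rule has_field_derivative_transform_within_open[of _ _ _ "{0<..}"])
        (use 3 in \<open>auto simp: flat_exp_def\<close>)
  qed
qed

lemma Ck_on_flat_exp:
  assumes S: "open S" and "Ck_on k S f"
  shows "Ck_on k S (\<lambda>z. flat_exp n (f z))"
  using assms(2)
proof (induction k arbitrary: n)
  case 0
  have "isCont (flat_exp n) t" for t
    using flat_exp_DERIV DERIV_isCont by blast
  then show ?case
    using 0 continuous_on_compose2[of UNIV "flat_exp n" S f]
    by (simp add: continuous_at_imp_continuous_on)
next
  case (Suc k)
  note D = Ck_on_SucD[OF Suc.prems]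
  have I: "Ck_on k S (\<lambda>z. flat_exp m (f z))" for m
    by (rule Suc.IH[OF Ck_on_lower[OF Suc.prems]])
  let ?d = "\<lambda>z. flat_exp (n + 2) (f z) + (- of_nat n) * flat_exp (n + 1) (f z)"
  have d: "((\<lambda>z. flat_exp n (f z)) has_derivative
      (\<lambda>u. frechet_derivative f (at z) u * ?d z)) (at z)"
    if "z \<in> S" for z
    using DERIV_compose_FDERIV[OF flat_exp_DERIV D(1)[OF that], of n] by simp
  show ?case
    by (rule Ck_on_SucI[OF S d], assumption)
      (intro Ck_on_bilinear[OF bounded_bilinear_mult S] Ck_on_add[OF S] Ck_on_const I D(2))
qed

section \<open>Smooth functions on a complex manifold\<close>

text \<open>A complex manifold, given by its atlas, whose points form a Hausdorff type.\<close>

locale complex_manifold =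
  fixes A :: "('m::t2_space, 'n::finite) chart set"
  assumes atlas: "complex_atlas A"
begin

lemma chartD:
  assumes "(U, \<phi>) \<in> A"
  shows "open U" "homeomorphism U (\<phi> ` U) \<phi> (inv_into U \<phi>)" "open (\<phi> ` U)"
  using assms atlas by (auto simp: complex_atlas_def chart_def)

lemma chart_inv: "(U, \<phi>) \<in> A \<Longrightarrow> x \<in> U \<Longrightarrow> inv_into U \<phi> (\<phi> x) = x"
  using chartD(2) by (meson homeomorphism_apply1)

lemma chart_around: obtains U \<phi> where "(U, \<phi>) \<in> A" "x \<in> U"
proof -
  have "x \<in> (\<Union>c\<in>A. fst c)"
    using atlas by (simp add: complex_atlas_def)
  then show ?thesis
    using that by force
qed

lemma open_chart_image:
  assumes "(U, \<phi>) \<in> A" "open W"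
  shows "open (\<phi> ` (U \<inter> W))"
proof -
  have "openin (top_of_set (\<phi> ` U)) (\<phi> ` (U \<inter> W))"
    by (rule homeomorphism_imp_open_map[OF chartD(2)[OF assms(1)]])
      (use assms in \<open>auto intro: openin_open_Int\<close>)
  then show ?thesis
    using openin_open_trans chartD(3)[OF assms(1)] by blast
qed

lemma smooth_map_iff:
  "smooth_map A W f \<longleftrightarrow>
    (\<forall>U \<phi> k. (U, \<phi>) \<in> A \<longrightarrow> Ck_on k (\<phi> ` (U \<inter> W)) (\<lambda>z. f (inv_into U \<phi> z)))"
  unfolding smooth_map_def smooth_on_def comp_def by fast

lemma smooth_map_subset: "smooth_map A W f \<Longrightarrow> V \<subseteq> W \<Longrightarrow> smooth_map A V f"
  unfolding smooth_map_iff by (blast intro: Ck_on_subset)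

lemma smooth_map_local:
  assumes "\<And>x. x \<in> W \<Longrightarrow> \<exists>N. open N \<and> x \<in> N \<and> smooth_map A N f"
  shows "smooth_map A W f"
  unfolding smooth_map_iff
proof (intro allI impI)
  fix U \<phi> k assume c: "(U, \<phi>) \<in> A"
  show "Ck_on k (\<phi> ` (U \<inter> W)) (\<lambda>z. f (inv_into U \<phi> z))"
  proof (rule Ck_on_local)
    fix z assume "z \<in> \<phi> ` (U \<inter> W)"
    then obtain x where x: "z = \<phi> x" "x \<in> U" "x \<in> W" by blast
    obtain N where "open N" "x \<in> N" "smooth_map A N f"
      using assms[OF x(3)] by blast
    then show "\<exists>T. open T \<and> z \<in> T \<and> Ck_on k T (\<lambda>z. f (inv_into U \<phi> z))"
      using c x open_chart_image[OF c] by (intro exI[of _ "\<phi> ` (U \<inter> N)"]) (auto simp: smooth_map_iff)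
  qed
qed

lemma smooth_map_cong:
  assumes "open W" "\<And>x. x \<in> W \<Longrightarrow> f x = g x" "smooth_map A W f"
  shows "smooth_map A W g"
  unfolding smooth_map_iff
proof (intro allI impI)
  fix U \<phi> k assume c: "(U, \<phi>) \<in> A"
  show "Ck_on k (\<phi> ` (U \<inter> W)) (\<lambda>z. g (inv_into U \<phi> z))"
    by (rule Ck_on_cong[OF open_chart_image[OF c assms(1)], of "\<lambda>z. f (inv_into U \<phi> z)"])
      (use assms c in \<open>auto simp: smooth_map_iff chart_inv\<close>)
qed

lemma smooth_map_const: "smooth_map A W (\<lambda>x. c)"
  by (simp add: smooth_map_iff Ck_on_const)

lemma smooth_map_add:
  "open W \<Longrightarrow> smooth_map A W f \<Longrightarrow> smooth_map A W g \<Longrightarrow> smooth_map A W (\<lambda>x. f x + g x)"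
  by (auto simp: smooth_map_iff intro!: Ck_on_add open_chart_image)

lemma smooth_map_sum:
  "open W \<Longrightarrow> (\<And>i. i \<in> I \<Longrightarrow> smooth_map A W (f i)) \<Longrightarrow> smooth_map A W (\<lambda>x. \<Sum>i\<in>I. f i x)"
  by (auto simp: smooth_map_iff intro!: Ck_on_sum open_chart_image)

lemma smooth_map_bounded_linear:
  "bounded_linear L \<Longrightarrow> open W \<Longrightarrow> smooth_map A W f \<Longrightarrow> smooth_map A W (\<lambda>x. L (f x))"
  by (simp add: smooth_map_iff Ck_on_bounded_linear[of L] open_chart_image)

lemma smooth_map_bilinear:
  "bounded_bilinear b \<Longrightarrow> open W \<Longrightarrow> smooth_map A W f \<Longrightarrow> smooth_map A W g \<Longrightarrow>
    smooth_map A W (\<lambda>x. b (f x) (g x))"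
  by (simp add: smooth_map_iff Ck_on_bilinear[of b] open_chart_image)

lemma smooth_map_diff:
  assumes "open W" "smooth_map A W f" "smooth_map A W g"
  shows "smooth_map A W (\<lambda>x. f x - g x)"
  using smooth_map_add[OF assms(1,2)
      smooth_map_bounded_linear[OF bounded_linear_minus[OF bounded_linear_ident] assms(1,3)]]
  by simp

lemma smooth_map_inverse:
  fixes f :: "'m \<Rightarrow> 'b::real_normed_field"
  shows "open W \<Longrightarrow> (\<And>x. x \<in> W \<Longrightarrow> f x \<noteq> 0) \<Longrightarrow> smooth_map A W f \<Longrightarrow>
    smooth_map A W (\<lambda>x. inverse (f x))"
  unfolding smooth_map_iff by (auto intro!: Ck_on_inverse open_chart_image simp: chart_inv)

lemma smooth_map_vec:
  fixes f :: "'m \<Rightarrow> 'b::euclidean_space^'k"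
  assumes "open W" "\<And>j. smooth_map A W (\<lambda>x. f x $ j)"
  shows "smooth_map A W f"
  using assms unfolding smooth_map_iff by (blast intro: Ck_on_vec open_chart_image)

lemma smooth_map_continuous_on:
  assumes "open W" "smooth_map A W f"
  shows "continuous_on W f"
proof (rule continuous_at_imp_continuous_on, rule ballI)
  fix x assume x: "x \<in> W"
  obtain U \<phi> where c: "(U, \<phi>) \<in> A" and xU: "x \<in> U" by (rule chart_around)
  have UW: "open (U \<inter> W)" using chartD(1)[OF c] assms(1) by blast
  have "Ck_on 0 (\<phi> ` (U \<inter> W)) (\<lambda>z. f (inv_into U \<phi> z))"
    using assms(2) c unfolding smooth_map_iff by blast
  moreover have "continuous_on (U \<inter> W) \<phi>"
    using homeomorphism_cont1[OF chartD(2)[OF c]] by (rule continuous_on_subset) auto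
  ultimately have "continuous_on (U \<inter> W) (\<lambda>y. f (inv_into U \<phi> (\<phi> y)))"
    using continuous_on_compose2[where f = \<phi> and s = "U \<inter> W"] by fastforce
  then have "continuous_on (U \<inter> W) f"
    by (rule continuous_on_eq) (use c in \<open>auto simp: chart_inv\<close>)
  then show "isCont f x"
    using UW x xU by (simp add: continuous_on_eq_continuous_at)
qed

lemma smooth_map_chart:
  assumes "(U, \<phi>) \<in> A"
  shows "smooth_map A U \<phi>"
proof (rule smooth_map_vec[OF chartD(1)[OF assms]])
  fix k
  show "smooth_map A U (\<lambda>x. \<phi> x $ k)"
    unfolding smooth_map_iff
  proof (intro allI impI)
    fix V \<phi>' l assume "(V, \<phi>') \<in> A"
    then have "holo_on (\<phi>' ` (V \<inter> U)) (\<lambda>z. \<phi> (inv_into V \<phi>' z) $ k)"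
      using atlas assms unfolding complex_atlas_def by blast
    then show "Ck_on l (\<phi>' ` (V \<inter> U)) (\<lambda>z. \<phi> (inv_into V \<phi>' z) $ k)"
      by (simp add: holo_on_def smooth_on_def)
  qed
qed

lemma smooth_map_flat_exp:
  "open W \<Longrightarrow> smooth_map A W f \<Longrightarrow> smooth_map A W (\<lambda>x. flat_exp n (f x))"
  by (auto simp: smooth_map_iff intro!: Ck_on_flat_exp open_chart_image)

lemma smooth_bump:
  assumes "open W" "x \<in> W"
  obtains \<beta> :: "'m \<Rightarrow> complex" and V K
  where "open V" "x \<in> V" "V \<subseteq> K" "closed K" "K \<subseteq> W" "smooth_map A UNIV \<beta>"
    "\<And>y. y \<in> V \<Longrightarrow> \<beta> y = 1" "\<And>y. y \<notin> K \<Longrightarrow> \<beta> y = 0"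
proof -
  obtain U \<phi> where c: "(U, \<phi>) \<in> A" and xU: "x \<in> U" by (rule chart_around)
  note hom = chartD(2)[OF c]
  have U: "open U" using chartD(1)[OF c] .
  obtain r where r: "r > 0" and ball: "cball (\<phi> x) r \<subseteq> \<phi> ` (U \<inter> W)"
    using open_contains_cball[of "\<phi> ` (U \<inter> W)"] open_chart_image[OF c assms(1)] xU assms(2) by blast
  define K where "K = inv_into U \<phi> ` cball (\<phi> x) r"
  define V where "V = U \<inter> \<phi> -` ball (\<phi> x) (r / 2)"
  have Keq: "K = {y \<in> U. \<phi> y \<in> cball (\<phi> x) r}"
  proof
    show "K \<subseteq> {y \<in> U. \<phi> y \<in> cball (\<phi> x) r}"
      using ball chart_inv[OF c] unfolding K_def by force
    show "{y \<in> U. \<phi> y \<in> cball (\<phi> x) r} \<subseteq> K"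
      unfolding K_def using chart_inv[OF c] by (metis (mono_tags, lifting) imageI mem_Collect_eq subsetI)
  qed
  \<comment> \<open>Here the Hausdorff property enters: a coordinate ball that is compact in the chart is closed in
    the whole manifold, so that extension by zero is smooth.\<close>
  have "compact K"
    unfolding K_def
    by (intro compact_continuous_image compact_cball continuous_on_subset[OF homeomorphism_cont2[OF hom]])
      (use ball in auto)
  then have K: "closed K" by (rule compact_imp_closed)
  have KW: "K \<subseteq> W"
    using ball chart_inv[OF c] unfolding K_def by force
  have V: "open V" "x \<in> V" "V \<subseteq> K"
    unfolding V_def Keq using U xU r homeomorphism_cont1[OF hom]
    by (auto intro!: continuous_open_preimage)
  \<comment> \<open>On \<open>U\<close>, \<open>\<beta>\<close> is the usual plateau function of the squared coordinate distance \<open>\<rho>\<close> to \<open>x\<close>: it is \<open>1\<close>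
    for \<open>\<rho> \<le> (r / 2)\<^sup>2\<close> and \<open>0\<close> for \<open>\<rho> \<ge> r\<^sup>2\<close>.\<close>
  define \<rho> where "\<rho> y = (\<phi> y - \<phi> x) \<bullet> (\<phi> y - \<phi> x)" for y
  define \<eta> where "\<eta> y = flat_exp 0 (r\<^sup>2 - \<rho> y)" for y
  define \<eta>' where "\<eta>' y = flat_exp 0 (\<rho> y - (r / 2)\<^sup>2)" for y
  define \<beta> :: "'m \<Rightarrow> complex"
    where "\<beta> y = (if y \<in> U then of_real (\<eta> y * inverse (\<eta> y + \<eta>' y)) else 0)" for y
  have \<rho>: "\<rho> y = (dist (\<phi> x) (\<phi> y))\<^sup>2" for y
    unfolding \<rho>_def by (subst dist_commute) (simp add: dist_norm power2_norm_eq_inner)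
  have "r / 2 < r" using r by simp
  then have "(r / 2)\<^sup>2 < r\<^sup>2" using r by (intro power_strict_mono) auto
  then have pos: "\<eta> y + \<eta>' y \<noteq> 0" for y
    by (auto simp: \<eta>_def \<eta>'_def flat_exp_def add_pos_pos[THEN less_imp_neq, symmetric])
  have out: "\<beta> y = 0" if "y \<notin> K" for y
  proof (cases "y \<in> U")
    case True
    then have "dist (\<phi> x) (\<phi> y) > r" using that by (auto simp: Keq)
    then have "\<rho> y \<ge> r\<^sup>2" unfolding \<rho> using r by (intro power_mono) auto
    then show ?thesis by (simp add: \<beta>_def \<eta>_def flat_exp_def)
  qed (simp add: \<beta>_def)
  have one: "\<beta> y = 1" if "y \<in> V" for y
  proof -
    have "dist (\<phi> x) (\<phi> y) < r / 2" "y \<in> U" using that by (auto simp: V_def)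
    then have "\<rho> y \<le> (r / 2)\<^sup>2" unfolding \<rho> by (intro power_mono) auto
    then have "\<eta>' y = 0" by (simp add: \<eta>'_def flat_exp_def)
    then show ?thesis using pos[of y] \<open>y \<in> U\<close> by (simp add: \<beta>_def)
  qed
  have "smooth_map A U \<rho>"
    unfolding \<rho>_def
    by (intro smooth_map_bilinear[OF bounded_bilinear_inner] smooth_map_diff smooth_map_const
        smooth_map_chart[OF c] U)
  then have \<eta>: "smooth_map A U \<eta>" "smooth_map A U \<eta>'"
    unfolding \<eta>_def \<eta>'_def
    by (intro smooth_map_flat_exp smooth_map_diff smooth_map_const U; assumption)+
  have "smooth_map A U (\<lambda>y. complex_of_real (\<eta> y * inverse (\<eta> y + \<eta>' y)))"
    by (intro smooth_map_bounded_linear[OF bounded_linear_of_real] U \<eta> pos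
        smooth_map_bilinear[OF bounded_bilinear_mult] smooth_map_inverse smooth_map_add)
  then have on_U: "smooth_map A U \<beta>"
    by (rule smooth_map_cong[OF U, rotated]) (simp add: \<beta>_def)
  have off_K: "smooth_map A (- K) \<beta>"
    by (rule smooth_map_cong[OF _ _ smooth_map_const[of _ 0]]) (use K out in auto)
  have "smooth_map A UNIV \<beta>"
  proof (rule smooth_map_local)
    fix y
    show "\<exists>N. open N \<and> y \<in> N \<and> smooth_map A N \<beta>"
    proof (cases "y \<in> U")
      case True
      then show ?thesis using on_U U by blast
    next
      case False
      then have "y \<in> - K" by (simp add: Keq)
      then show ?thesis using off_K K by (blast intro: open_Compl)
    qed
  qed
  with V K KW out one show ?thesis using that by blast
qed

end

section \<open>Smooth sections and the orthogonal projection\<close>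

lemma bounded_bilinear_matrix_vector:
  "bounded_bilinear ((*v) :: complex^'k^'l \<Rightarrow> complex^'k \<Rightarrow> complex^'l)"
  unfolding bilinear_conv_bounded_bilinear[symmetric]
  by (simp add: bilinear_def linear_iff vec_eq_iff matrix_vector_mult_def
      ring_distribs sum.distrib scaleR_sum_right)

lemma bounded_bilinear_scalar_vector:
  "bounded_bilinear ((*s) :: complex \<Rightarrow> complex^'k \<Rightarrow> complex^'k)"
  unfolding bilinear_conv_bounded_bilinear[symmetric]
  by (simp add: bilinear_def linear_iff vec_eq_iff ring_distribs)

lemma matrix_inv_cancel:
  fixes M :: "complex^'k^'k"
  assumes "invertible M"
  shows "M *v (matrix_inv M *v v) = v" "matrix_inv M *v (M *v v) = v"
proof -
  have "M ** matrix_inv M = mat 1 \<and> matrix_inv M ** M = mat 1"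
    using assms unfolding invertible_def matrix_inv_def by (rule someI_ex)
  then show "M *v (matrix_inv M *v v) = v" "matrix_inv M *v (M *v v) = v"
    by (simp_all add: matrix_vector_mul_assoc)
qed

text \<open>A holomorphic vector bundle \<open>E\<close> over a complex manifold with a hermitian metric.\<close>

locale hermitian_bundle = complex_manifold A
  for A :: "('m::t2_space, 'n::finite) chart set" +
  fixes B :: "('m, 'r::finite) triv set" and h :: "('m, 'r) herm"
  assumes hol_bundle: "holomorphic_vector_bundle A B" and herm_metric: "hermitian_metric A B h"
begin

lemma h_add_left: "h x (u + u') w = h x u w + h x u' w"
  and h_smult_left: "h x (a *s u) w = a * h x u w"
  and h_zero_left [simp]: "h x 0 w = 0"
proof -
  have *: "h x (a *s u + u') w = a * h x u w + h x u' w" for a u u' w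
    using herm_metric unfolding hermitian_metric_def by blast
  show add: "h x (u + u') w = h x u w + h x u' w" for u u' w
    using *[of 1 u u' w] by simp
  show zero: "h x 0 w = 0" for w
    using add[of 0 0 w] by simp
  show "h x (a *s u) w = a * h x u w"
    using *[of a u 0 w] zero by simp
qed

lemma h_cnj: "h x w u = cnj (h x u w)"
  using herm_metric unfolding hermitian_metric_def by blast

lemma h_add_right: "h x w (u + u') = h x w u + h x w u'"
  by (subst (1 2 3) h_cnj) (simp add: h_add_left)

lemma h_smult_right: "h x w (a *s u) = cnj a * h x w u"
  by (subst (1 2) h_cnj) (simp add: h_smult_left)

lemma h_zero_right [simp]: "h x w 0 = 0"
  by (subst h_cnj) simp

lemma h_diff_left: "h x (u - u') w = h x u w - h x u' w"
  using h_add_left[of x "u - u'" u' w] by simp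

lemma h_diff_right: "h x w (u - u') = h x w u - h x w u'"
  using h_add_right[of x w "u - u'" u'] by simp

lemma h_sum_left: "h x (\<Sum>i\<in>I. f i) w = (\<Sum>i\<in>I. h x (f i) w)"
  by (induction I rule: infinite_finite_induct) (auto simp: h_add_left)

lemma h_sum_right: "h x w (\<Sum>i\<in>I. f i) = (\<Sum>i\<in>I. h x w (f i))"
  by (induction I rule: infinite_finite_induct) (auto simp: h_add_right)

lemma h_nonzero: "u \<noteq> 0 \<Longrightarrow> h x u u \<noteq> 0"
  using herm_metric unfolding hermitian_metric_def by (metis less_irrefl zero_complex.simps(1))

lemma h_span_left:
  assumes "\<And>u. u \<in> S \<Longrightarrow> h x u w = 0" "v \<in> vec.span S"
  shows "h x v w = 0"
  using assms(2)
  by (induction rule: vec.span_induct_alt) (auto simp: h_add_left h_smult_left assms(1))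

lemma trivD:
  assumes "(W, \<psi>) \<in> B"
  shows "open W" "x \<in> W \<Longrightarrow> invertible (\<psi> x)"
  using assms hol_bundle unfolding holomorphic_vector_bundle_def by auto

lemma triv_around: obtains W \<psi> where "(W, \<psi>) \<in> B" "x \<in> W"
proof -
  have "x \<in> (\<Union>\<tau>\<in>B. fst \<tau>)"
    using hol_bundle by (simp add: holomorphic_vector_bundle_def)
  then show ?thesis
    using that by force
qed

text \<open>Smoothness of a section of \<open>E\<close> over \<open>W\<close>; its values outside \<open>W\<close> are irrelevant.\<close>

definition smooth_section :: "'m set \<Rightarrow> ('m \<Rightarrow> complex^'r) \<Rightarrow> bool" where
  "smooth_section W s \<longleftrightarrow> (\<forall>(W', \<psi>)\<in>B. smooth_map A (W \<inter> W') (\<lambda>x. \<psi> x *v s x))"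

lemma smooth_sectionI:
  "(\<And>W' \<psi>. (W', \<psi>) \<in> B \<Longrightarrow> smooth_map A (W \<inter> W') (\<lambda>x. \<psi> x *v s x)) \<Longrightarrow> smooth_section W s"
  unfolding smooth_section_def by fast

lemma smooth_sectionD:
  "smooth_section W s \<Longrightarrow> (W', \<psi>) \<in> B \<Longrightarrow> smooth_map A (W \<inter> W') (\<lambda>x. \<psi> x *v s x)"
  unfolding smooth_section_def by fast

lemma A0_iff: "s \<in> A0 A B F \<longleftrightarrow> (\<forall>x. s x \<in> F x) \<and> smooth_section UNIV s"
  by (auto simp: A0_def smooth_section_def)

lemma A0_UNIV_iff: "s \<in> A0 A B (\<lambda>_. UNIV) \<longleftrightarrow> smooth_section UNIV s"
  by (simp add: A0_iff)

lemma smooth_section_subset: "smooth_section W s \<Longrightarrow> V \<subseteq> W \<Longrightarrow> smooth_section V s"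
  unfolding smooth_section_def by (blast intro: smooth_map_subset)

lemma smooth_section_cong:
  assumes "open W" "\<And>x. x \<in> W \<Longrightarrow> s x = t x" "smooth_section W s"
  shows "smooth_section W t"
proof (rule smooth_sectionI)
  fix W' \<psi> assume \<tau>: "(W', \<psi>) \<in> B"
  show "smooth_map A (W \<inter> W') (\<lambda>x. \<psi> x *v t x)"
    by (rule smooth_map_cong[OF _ _ smooth_sectionD[OF assms(3) \<tau>]])
      (use assms trivD[OF \<tau>] in auto)
qed

lemma smooth_section_local:
  assumes "\<And>x. x \<in> W \<Longrightarrow> \<exists>N. open N \<and> x \<in> N \<and> smooth_section N s"
  shows "smooth_section W s"
proof (rule smooth_sectionI, rule smooth_map_local)
  fix W' \<psi> x assume \<tau>: "(W', \<psi>) \<in> B" and x: "x \<in> W \<inter> W'"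
  obtain N where "open N" "x \<in> N" "smooth_section N s"
    using assms x by blast
  then show "\<exists>N. open N \<and> x \<in> N \<and> smooth_map A N (\<lambda>x. \<psi> x *v s x)"
    using trivD(1)[OF \<tau>] x smooth_sectionD[OF _ \<tau>] by (intro exI[of _ "N \<inter> W'"]) auto
qed

lemma smooth_section_zero: "smooth_section W (\<lambda>x. 0)"
  by (rule smooth_sectionI) (simp add: smooth_map_const)

lemma smooth_section_add:
  assumes "open W" "smooth_section W s" "smooth_section W t"
  shows "smooth_section W (\<lambda>x. s x + t x)"
proof (rule smooth_sectionI)
  fix W' \<psi> assume \<tau>: "(W', \<psi>) \<in> B"
  show "smooth_map A (W \<inter> W') (\<lambda>x. \<psi> x *v (s x + t x))"
    using smooth_map_add[OF _ smooth_sectionD[OF assms(2) \<tau>] smooth_sectionD[OF assms(3) \<tau>]]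
      assms(1) trivD(1)[OF \<tau>] by (simp add: matrix_vector_right_distrib open_Int)
qed

lemma smooth_section_smult:
  assumes "open W" "smooth_map A W f" "smooth_section W s"
  shows "smooth_section W (\<lambda>x. f x *s s x)"
proof (rule smooth_sectionI)
  fix W' \<psi> assume \<tau>: "(W', \<psi>) \<in> B"
  have "smooth_map A (W \<inter> W') (\<lambda>x. f x *s (\<psi> x *v s x))"
    using assms trivD(1)[OF \<tau>]
    by (intro smooth_map_bilinear[OF bounded_bilinear_scalar_vector] smooth_sectionD[OF _ \<tau>]
        smooth_map_subset[OF assms(2)]) auto
  then show "smooth_map A (W \<inter> W') (\<lambda>x. \<psi> x *v (f x *s s x))"
    by (simp add: vector_scalar_commute)
qed

lemma smooth_section_diff:
  assumes "open W" "smooth_section W s" "smooth_section W t"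
  shows "smooth_section W (\<lambda>x. s x - t x)"
  using smooth_section_add[OF assms(1,2) smooth_section_smult[OF assms(1) smooth_map_const assms(3)], of "-1"]
  by (simp add: vector_sneg_minus1[symmetric])

lemma holo_section_imp_smooth:
  assumes "open W" "holo_section A B W s"
  shows "smooth_section W s"
proof (rule smooth_sectionI)
  fix W' \<psi> assume \<tau>: "(W', \<psi>) \<in> B"
  show "smooth_map A (W \<inter> W') (\<lambda>x. \<psi> x *v s x)"
  proof (rule smooth_map_vec)
    show "open (W \<inter> W')" using assms(1) trivD(1)[OF \<tau>] by blast
    fix j
    have "holo_map A (W \<inter> W') (\<lambda>x. (\<psi> x *v s x) $ j)"
      using assms(2) \<tau> unfolding holo_section_def by blast
    then show "smooth_map A (W \<inter> W') (\<lambda>x. (\<psi> x *v s x) $ j)"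
      by (auto simp: holo_map_def smooth_map_def holo_on_def)
  qed
qed

text \<open>The sections that are constant in the trivialisation \<open>\<psi>\<close>; in any other trivialisation they are
  given by a transition function.\<close>

lemma smooth_section_constant:
  assumes "(W, \<psi>) \<in> B"
  shows "smooth_section W (\<lambda>x. matrix_inv (\<psi> x) *v a)"
proof (rule smooth_sectionI)
  fix W' \<psi>' assume \<tau>: "(W', \<psi>') \<in> B"
  have op: "open (W \<inter> W')" using trivD(1)[OF \<tau>] trivD(1)[OF assms] by blast
  have "smooth_map A (W \<inter> W') (\<lambda>x. (\<psi>' x ** matrix_inv (\<psi> x)) $ j $ k)" for j k
  proof -
    have "holo_map A (W \<inter> W') (\<lambda>x. (\<psi>' x ** matrix_inv (\<psi> x)) $ j $ k)"
      using hol_bundle assms \<tau> unfolding holomorphic_vector_bundle_def by blast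
    then show ?thesis
      by (auto simp: holo_map_def smooth_map_def holo_on_def)
  qed
  then have "smooth_map A (W \<inter> W') (\<lambda>x. (\<psi>' x ** matrix_inv (\<psi> x)) *v a)"
    by (intro smooth_map_bilinear[OF bounded_bilinear_matrix_vector] smooth_map_const op
        smooth_map_vec)
  then show "smooth_map A (W \<inter> W') (\<lambda>x. \<psi>' x *v (matrix_inv (\<psi> x) *v a))"
    by (simp add: matrix_vector_mul_assoc)
qed

lemma smooth_map_h:
  assumes "open W" "smooth_section W s" "smooth_section W t"
  shows "smooth_map A W (\<lambda>x. h x (s x) (t x))"
proof (rule smooth_map_local)
  fix x assume x: "x \<in> W"
  obtain W' \<psi> where \<tau>: "(W', \<psi>) \<in> B" and xW': "x \<in> W'" by (rule triv_around)
  let ?V = "W \<inter> W'" and ?e = "\<lambda>y k. matrix_inv (\<psi> y) *v axis k 1"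
  have V: "open ?V" using assms(1) trivD(1)[OF \<tau>] by blast
  \<comment> \<open>Expand both arguments in the frame of \<open>E\<close> given by \<open>\<psi>\<close>.\<close>
  have exp: "v = (\<Sum>k\<in>UNIV. (\<psi> y *v v) $ k *s ?e y k)" if "y \<in> ?V" for y v
  proof -
    have "matrix_inv (\<psi> y) *v (\<psi> y *v v) =
        matrix_inv (\<psi> y) *v (\<Sum>k\<in>UNIV. (\<psi> y *v v) $ k *s axis k 1)"
      by (simp only: basis_expansion)
    also have "\<dots> = (\<Sum>k\<in>UNIV. (\<psi> y *v v) $ k *s ?e y k)"
      by (simp only: vec.sum vec.scale)
    finally have "matrix_inv (\<psi> y) *v (\<psi> y *v v) = (\<Sum>k\<in>UNIV. (\<psi> y *v v) $ k *s ?e y k)" .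
    then show ?thesis
      using matrix_inv_cancel(2)[OF trivD(2)[OF \<tau>]] that by simp
  qed
  have "smooth_map A ?V (\<lambda>y. \<Sum>k\<in>UNIV. \<Sum>l\<in>UNIV.
      (\<psi> y *v s y) $ k * (cnj ((\<psi> y *v t y) $ l) * h y (?e y k) (?e y l)))"
  proof (intro smooth_map_sum smooth_map_bilinear[OF bounded_bilinear_mult] V
      smooth_map_bounded_linear[OF bounded_linear_cnj]
      smooth_map_bounded_linear[OF bounded_linear_vec_nth] smooth_sectionD[OF _ \<tau>] assms)
    fix k l
    have "smooth_map A W' (\<lambda>y. h y (?e y k) (?e y l))"
      using herm_metric \<tau> unfolding hermitian_metric_def by blast
    then show "smooth_map A ?V (\<lambda>y. h y (?e y k) (?e y l))"
      by (rule smooth_map_subset) auto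
  qed
  moreover have "(\<Sum>k\<in>UNIV. \<Sum>l\<in>UNIV.
      (\<psi> y *v s y) $ k * (cnj ((\<psi> y *v t y) $ l) * h y (?e y k) (?e y l))) = h y (s y) (t y)"
    if "y \<in> ?V" for y
  proof -
    have "h y (s y) (t y) =
        h y (\<Sum>k\<in>UNIV. (\<psi> y *v s y) $ k *s ?e y k) (\<Sum>l\<in>UNIV. (\<psi> y *v t y) $ l *s ?e y l)"
      by (rule arg_cong2[where f = "h y", OF exp[OF that] exp[OF that]])
    then show ?thesis
      by (simp only: h_sum_left h_smult_left)
        (simp add: h_sum_right h_smult_right sum_distrib_left)
  qed
  ultimately have "smooth_map A ?V (\<lambda>y. h y (s y) (t y))"
    by (rule smooth_map_cong[OF V, rotated])
  then show "\<exists>N. open N \<and> x \<in> N \<and> smooth_map A N (\<lambda>x. h x (s x) (t x))"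
    using V x xW' by blast
qed

text \<open>Gram-Schmidt orthogonalisation of a section against a frame, depending smoothly on the
  point.\<close>

lemma smooth_orthogonalization:
  fixes k :: nat
  assumes "open W"
    and "\<And>i. i < k \<Longrightarrow> smooth_section W (e i)"
    and "\<And>y. y \<in> W \<Longrightarrow> inj_on (\<lambda>i. e i y) {..<k}"
    and "\<And>y. y \<in> W \<Longrightarrow> vec.independent ((\<lambda>i. e i y) ` {..<k})"
    and "smooth_section W s"
  shows "\<exists>t. smooth_section W t \<and>
    (\<forall>y\<in>W. s y - t y \<in> vec.span ((\<lambda>i. e i y) ` {..<k}) \<and> (\<forall>i<k. h y (e i y) (t y) = 0))"
  using assms(2-)
proof (induction k arbitrary: s)
  case 0
  then show ?case by (auto intro!: exI[of _ s])
next
  case (Suc k)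
  let ?S = "\<lambda>y. (\<lambda>i. e i y) ` {..<k}"
  have ins: "(\<lambda>i. e i y) ` {..<Suc k} = insert (e k y) (?S y)" for y
    by (simp add: lessThan_Suc)
  have new: "e k y \<notin> ?S y" if "y \<in> W" for y
    using inj_onD[OF Suc.prems(2)[OF that], of k] by force
  have inj: "inj_on (\<lambda>i. e i y) {..<k}" if "y \<in> W" for y
    using Suc.prems(2)[OF that] by (rule inj_on_subset) auto
  have ind: "vec.independent (?S y)" "e k y \<notin> vec.span (?S y)" if "y \<in> W" for y
    using Suc.prems(3)[OF that] new[OF that] unfolding ins vec.independent_insert by auto
  have IH: "\<exists>t. smooth_section W t \<and>
      (\<forall>y\<in>W. s y - t y \<in> vec.span (?S y) \<and> (\<forall>i<k. h y (e i y) (t y) = 0))"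
    if "smooth_section W s" for s
    by (rule Suc.IH) (use Suc.prems(1) inj ind that in auto)
  obtain t where t: "smooth_section W t"
    "\<And>y. y \<in> W \<Longrightarrow> s y - t y \<in> vec.span (?S y)"
    "\<And>y i. y \<in> W \<Longrightarrow> i < k \<Longrightarrow> h y (e i y) (t y) = 0"
    using IH[OF Suc.prems(4)] by blast
  obtain g where g: "smooth_section W g"
    "\<And>y. y \<in> W \<Longrightarrow> e k y - g y \<in> vec.span (?S y)"
    "\<And>y i. y \<in> W \<Longrightarrow> i < k \<Longrightarrow> h y (e i y) (g y) = 0"
    using IH[of "e k"] Suc.prems(1) by blast
  have gnz: "h y (g y) (g y) \<noteq> 0" if "y \<in> W" for y
    using g(2)[OF that] ind(2)[OF that] by (intro h_nonzero) auto
  \<comment> \<open>\<open>g\<close> is the part of the last frame vector orthogonal to the others; it remains to remove from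
    \<open>t\<close> its component along \<open>g\<close>.\<close>
  define c where "c y = h y (t y) (g y) * inverse (h y (g y) (g y))" for y
  define t' where "t' y = t y - c y *s g y" for y
  have "smooth_map A W c"
    unfolding c_def
    by (intro smooth_map_bilinear[OF bounded_bilinear_mult] smooth_map_inverse smooth_map_h
        assms(1) t(1) g(1) gnz)
  then have "smooth_section W t'"
    unfolding t'_def by (intro smooth_section_diff smooth_section_smult assms(1) t(1) g(1))
  moreover have "s y - t' y \<in> vec.span ((\<lambda>i. e i y) ` {..<Suc k})" if "y \<in> W" for y
  proof -
    have sub: "vec.span (?S y) \<subseteq> vec.span (insert (e k y) (?S y))"
      by (rule vec.span_mono) auto
    have "g y = e k y - (e k y - g y)" by simp
    also have "\<dots> \<in> vec.span (insert (e k y) (?S y))"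
      by (rule vec.span_diff[OF vec.span_base]) (use g(2)[OF that] sub in auto)
    finally have "(s y - t y) + c y *s g y \<in> vec.span (insert (e k y) (?S y))"
      using t(2)[OF that] sub by (intro vec.span_add vec.span_scale) auto
    then show ?thesis by (simp add: ins t'_def algebra_simps)
  qed
  moreover have "h y (e i y) (t' y) = 0" if y: "y \<in> W" and i: "i < Suc k" for y i
  proof -
    have low: "h y (e j y) (t' y) = 0" if "j < k" for j
      using t(3)[OF y that] g(3)[OF y that] by (simp add: t'_def h_diff_right h_smult_right)
    have "h y (e k y - g y) (t' y) = 0"
      by (rule h_span_left[OF _ g(2)[OF y]]) (auto simp: low)
    moreover have "h y (g y) (t' y) = 0"
      using gnz[OF y] h_cnj[of y "g y" "g y"] h_cnj[of y "g y" "t y"]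
      by (simp add: t'_def h_diff_right h_smult_right c_def)
    ultimately have "h y (e k y) (t' y) = 0"
      by (simp add: h_diff_left)
    then show ?thesis using low i less_Suc_eq by metis
  qed
  ultimately show ?case by blast
qed

end

text \<open>A holomorphic subbundle \<open>F\<close> of the hermitian bundle \<open>E\<close>.\<close>

locale hermitian_subbundle = hermitian_bundle A B h
  for A :: "('m::t2_space, 'n::finite) chart set" and B :: "('m, 'r::finite) triv set"
    and h :: "('m, 'r) herm" +
  fixes F :: "'m \<Rightarrow> (complex^'r) set"
  assumes subbundle: "holomorphic_subbundle A B F"
begin

abbreviation F_orth :: "'m \<Rightarrow> (complex^'r) set" where
  "F_orth \<equiv> orth_complement h F"

lemma subspace_F: "vec.subspace (F x)"
proof -
  obtain S where "vec.span S = F x"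
    using subbundle unfolding holomorphic_subbundle_def by metis
  then show ?thesis using vec.subspace_span by metis
qed

lemma subspace_orth: "vec.subspace (F_orth x)"
  by (auto simp: vec.subspace_def orth_complement_def h_add_right h_smult_right)

lemma F_Int_orth: "u \<in> F x \<Longrightarrow> u \<in> F_orth x \<Longrightarrow> u = 0"
  using h_nonzero by (auto simp: orth_complement_def)

text \<open>The neighbourhood \<open>W\<close> depends on \<open>x\<close> only, not on the section to be split.\<close>

lemma local_orthogonal_splitting:
  obtains W where "open W" "x \<in> W"
    "\<And>V s. \<lbrakk>open V; V \<subseteq> W; smooth_section V s\<rbrakk> \<Longrightarrow>
      \<exists>t. smooth_section V t \<and> (\<forall>y\<in>V. s y - t y \<in> F y \<and> t y \<in> F_orth y)"
proof -
  obtain W k e where W: "open W" "x \<in> W" "\<forall>i<(k::nat). holo_section A B W (e i)"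
    and frame: "\<forall>y\<in>W. inj_on (\<lambda>i. e i y) {..<k} \<and> vec.independent ((\<lambda>i. e i y) ` {..<k}) \<and>
      vec.span ((\<lambda>i. e i y) ` {..<k}) = F y"
    using spec[OF subbundle[unfolded holomorphic_subbundle_def], of x] by (elim exE conjE) (rule that; assumption)
  show ?thesis
  proof (rule that[OF W(1,2)])
    fix V s assume V: "open V" "V \<subseteq> W" and s: "smooth_section V s"
    have "smooth_section V (e i)" if "i < k" for i
      using W that V holo_section_imp_smooth smooth_section_subset by blast
    then obtain t where t: "smooth_section V t"
      "\<forall>y\<in>V. s y - t y \<in> vec.span ((\<lambda>i. e i y) ` {..<k}) \<and> (\<forall>i<k. h y (e i y) (t y) = 0)"
      using smooth_orthogonalization[OF V(1) _ _ _ s, of k e] frame V(2) by blast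
    have "t y \<in> F_orth y" if y: "y \<in> V" for y
      unfolding orth_complement_def
    proof (intro CollectI ballI)
      fix u assume "u \<in> F y"
      then have "u \<in> vec.span ((\<lambda>i. e i y) ` {..<k})" using frame V(2) y by blast
      then show "h y u (t y) = 0"
        by (rule h_span_left[rotated]) (use t(2) y in auto)
    qed
    with t frame V(2) show "\<exists>t. smooth_section V t \<and> (\<forall>y\<in>V. s y - t y \<in> F y \<and> t y \<in> F_orth y)"
      by blast
  qed
qed

text \<open>The orthogonal projection of \<open>E\<^sub>x\<close> onto the complement of \<open>F\<^sub>x\<close>. The description is proper: lemma
  \<open>proj_eqI\<close> rests on the uniqueness of the splitting, lemma \<open>proj_orth\<close> on its existence.\<close>

definition proj :: "'m \<Rightarrow> complex^'r \<Rightarrow> complex^'r" where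
  "proj x e = (THE w. w \<in> F_orth x \<and> e - w \<in> F x)"

lemma proj_eqI:
  assumes "w \<in> F_orth x" "e - w \<in> F x"
  shows "proj x e = w"
  unfolding proj_def
proof (rule the_equality)
  fix w' assume w': "w' \<in> F_orth x \<and> e - w' \<in> F x"
  have "w' - w \<in> F_orth x"
    using w' assms by (blast intro: vec.subspace_diff[OF subspace_orth])
  moreover have "(e - w) - (e - w') \<in> F x"
    using w' assms by (blast intro: vec.subspace_diff[OF subspace_F])
  ultimately show "w' = w" using F_Int_orth[of "w' - w" x] by simp
qed (use assms in blast)

lemma proj_orth: "proj x e \<in> F_orth x" and diff_proj: "e - proj x e \<in> F x"
proof -
  obtain W \<psi> where \<tau>: "(W, \<psi>) \<in> B" "x \<in> W" by (rule triv_around)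
  obtain V where V: "open V" "x \<in> V"
    and split: "\<And>U s. \<lbrakk>open U; U \<subseteq> V; smooth_section U s\<rbrakk> \<Longrightarrow>
      \<exists>t. smooth_section U t \<and> (\<forall>y\<in>U. s y - t y \<in> F y \<and> t y \<in> F_orth y)"
    by (rule local_orthogonal_splitting[of x]) blast
  let ?s = "\<lambda>y. matrix_inv (\<psi> y) *v (\<psi> x *v e)"
  have "smooth_section (W \<inter> V) ?s"
    using smooth_section_constant[OF \<tau>(1)] by (rule smooth_section_subset) auto
  then obtain t where "\<forall>y\<in>W \<inter> V. ?s y - t y \<in> F y \<and> t y \<in> F_orth y"
    using split[of "W \<inter> V"] V(1) trivD(1)[OF \<tau>(1)] by blast
  then have "t x \<in> F_orth x" "e - t x \<in> F x"
    using \<tau>(2) V(2) matrix_inv_cancel(2)[OF trivD(2)[OF \<tau>], of e] by force+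
  then show "proj x e \<in> F_orth x" "e - proj x e \<in> F x"
    using proj_eqI by metis+
qed

lemma proj_add: "proj x (e + e') = proj x e + proj x e'"
proof (rule proj_eqI)
  show "proj x e + proj x e' \<in> F_orth x"
    by (intro vec.subspace_add[OF subspace_orth] proj_orth)
  have "(e - proj x e) + (e' - proj x e') \<in> F x"
    by (intro vec.subspace_add[OF subspace_F] diff_proj)
  then show "e + e' - (proj x e + proj x e') \<in> F x" by (simp add: algebra_simps)
qed

lemma proj_diff: "proj x (e - e') = proj x e - proj x e'"
  using proj_add[of x "e - e'" e'] by (simp add: eq_diff_eq)

lemma proj_smult: "proj x (a *s e) = a *s proj x e"
proof (rule proj_eqI)
  show "a *s proj x e \<in> F_orth x"
    by (intro vec.subspace_scale[OF subspace_orth] proj_orth)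
  have "a *s (e - proj x e) \<in> F x"
    by (intro vec.subspace_scale[OF subspace_F] diff_proj)
  then show "a *s e - a *s proj x e \<in> F x" by (simp add: vector_ssub_ldistrib)
qed

lemma proj_id: "e \<in> F_orth x \<Longrightarrow> proj x e = e"
  by (rule proj_eqI) (auto simp: vec.subspace_0[OF subspace_F])

lemma proj_zero: "e \<in> F x \<Longrightarrow> proj x e = 0"
  by (rule proj_eqI) (auto simp: vec.subspace_0[OF subspace_orth])

lemma smooth_section_proj:
  assumes "smooth_section UNIV s"
  shows "smooth_section UNIV (\<lambda>y. proj y (s y))"
proof (rule smooth_section_local)
  fix x
  obtain V where V: "open V" "x \<in> V"
    and split: "\<And>U s. \<lbrakk>open U; U \<subseteq> V; smooth_section U s\<rbrakk> \<Longrightarrow>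
      \<exists>t. smooth_section U t \<and> (\<forall>y\<in>U. s y - t y \<in> F y \<and> t y \<in> F_orth y)"
    by (rule local_orthogonal_splitting[of x]) blast
  have "smooth_section V s" using assms by (rule smooth_section_subset) auto
  then obtain t where t: "smooth_section V t" "\<forall>y\<in>V. s y - t y \<in> F y \<and> t y \<in> F_orth y"
    using split V by blast
  have "smooth_section V (\<lambda>y. proj y (s y))"
    by (rule smooth_section_cong[OF V(1) _ t(1)]) (use t(2) proj_eqI in force)
  then show "\<exists>N. open N \<and> x \<in> N \<and> smooth_section N (\<lambda>y. proj y (s y))"
    using V by blast
qed

lemma proj_A0:
  assumes "smooth_section UNIV s"
  shows "(\<lambda>y. proj y (s y)) \<in> A0 A B F_orth" "(\<lambda>y. s y - proj y (s y)) \<in> A0 A B F"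
  using assms by (auto simp: A0_iff proj_orth diff_proj smooth_section_proj
      intro!: smooth_section_diff)

end

section \<open>Tangent vectors, cut-off sections and endomorphism-valued forms\<close>

context complex_manifold
begin

lemma tvec_in_tangent_space: "c \<in> A \<Longrightarrow> x \<in> fst c \<Longrightarrow> tvec A c x u \<in> tangent_space A x"
  unfolding tangent_space_def by blast

lemma tvec_eq:
  assumes "open W" "x \<in> W" "smooth_map A W f"
  shows "tvec A (U, \<phi>) x u f = frechet_derivative (f \<circ> inv_into U \<phi>) (at (\<phi> x)) u"
  using assms unfolding tvec_def by auto

lemma tvec_locally_constant:
  assumes "c \<in> A" "x \<in> fst c" "open W" "x \<in> W" "\<And>y. y \<in> W \<Longrightarrow> f y = a"
  shows "tvec A c x u f = 0"
proof -
  obtain U \<phi> where c: "c = (U, \<phi>)" by (cases c)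
  have "smooth_map A W f"
    by (rule smooth_map_cong[OF assms(3) _ smooth_map_const[of _ a]]) (simp add: assms(5))
  moreover have "((f \<circ> inv_into U \<phi>) has_derivative (\<lambda>_. 0)) (at (\<phi> x))"
  proof (rule has_derivative_transform_within_open[OF has_derivative_const])
    show "open (\<phi> ` (U \<inter> W))" using open_chart_image assms(1,3) c by blast
    show "\<phi> x \<in> \<phi> ` (U \<inter> W)" using assms c by simp
    show "a = (f \<circ> inv_into U \<phi>) z" if "z \<in> \<phi> ` (U \<inter> W)" for z
      using that assms c by (auto simp: chart_inv)
  qed
  ultimately show ?thesis
    using tvec_eq[OF assms(3,4)] frechet_derivative_at[symmetric] by (metis c)
qed

lemma tangent_zero_function: "v \<in> tangent_space A x \<Longrightarrow> v (\<lambda>_. 0) = 0"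
  unfolding tangent_space_def by (auto intro: tvec_locally_constant[of _ _ UNIV])

end

context hermitian_bundle
begin

text \<open>Sections that are constant near \<open>x\<close> in a holomorphic trivialisation extend to global smooth
  sections, linearly in the constant near \<open>x\<close>.\<close>

lemma locally_constant_sections:
  obtains V W \<psi> \<sigma> where "open V" "x \<in> V" "V \<subseteq> W" "(W, \<psi>) \<in> B"
    "\<And>a. smooth_section UNIV (\<sigma> a)"
    "\<And>a y. y \<in> V \<Longrightarrow> \<sigma> a y = matrix_inv (\<psi> y) *v a"
proof -
  obtain W \<psi> where \<tau>: "(W, \<psi>) \<in> B" "x \<in> W" by (rule triv_around)
  note W = trivD(1)[OF \<tau>(1)]
  obtain \<beta> :: "'m \<Rightarrow> complex" and V K where bump: "open V" "x \<in> V" "V \<subseteq> K" "closed K" "K \<subseteq> W"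
    "smooth_map A UNIV \<beta>" "\<And>y. y \<in> V \<Longrightarrow> \<beta> y = 1" "\<And>y. y \<notin> K \<Longrightarrow> \<beta> y = 0"
    by (rule smooth_bump[OF W \<tau>(2)]) blast
  define \<sigma> where "\<sigma> a y = \<beta> y *s (matrix_inv (\<psi> y) *v a)" for a y
  have sm: "smooth_section UNIV (\<sigma> a)" for a
  proof (rule smooth_section_local)
    fix y
    have on_W: "smooth_section W (\<sigma> a)"
      unfolding \<sigma>_def
      by (intro smooth_section_smult W smooth_section_constant \<tau> smooth_map_subset[OF bump(6)]) auto
    have off_K: "smooth_section (- K) (\<sigma> a)"
      by (rule smooth_section_cong[OF _ _ smooth_section_zero]) (use bump in \<open>auto simp: \<sigma>_def\<close>)
    show "\<exists>N. open N \<and> y \<in> N \<and> smooth_section N (\<sigma> a)"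
      using on_W off_K W bump(4,5) by (cases "y \<in> W") (blast intro: open_Compl)+
  qed
  show ?thesis
  proof (rule that[OF bump(1,2) _ \<tau>(1) sm])
    show "V \<subseteq> W" using bump(3,5) by blast
    show "\<sigma> a y = matrix_inv (\<psi> y) *v a" if "y \<in> V" for a y
      using bump(7)[OF that] by (simp add: \<sigma>_def)
  qed
qed

lemma A1_add:
  assumes "\<alpha> \<in> A1 A B (\<lambda>_. UNIV)" "\<beta> \<in> A1 A B (\<lambda>_. UNIV)"
  shows "(\<lambda>x v. \<alpha> x v + \<beta> x v) \<in> A1 A B (\<lambda>_. UNIV)"
  unfolding A1_def
proof (intro CollectI conjI ballI allI; (clarify)?)
  fix U \<phi> x assume "(U, \<phi>) \<in> A" "x \<in> fst (U, \<phi>)"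
  then show "linear (\<lambda>u. \<alpha> x (tvec A (U, \<phi>) x u) + \<beta> x (tvec A (U, \<phi>) x u))"
    using assms unfolding A1_def by (intro linear_compose_add) blast+
next
  fix U \<phi> W \<psi> u assume c: "(U, \<phi>) \<in> A" and \<tau>: "(W, \<psi>) \<in> B"
  have sm: "smooth_map A (fst (U, \<phi>) \<inter> W) (\<lambda>x. \<psi> x *v \<gamma> x (tvec A (U, \<phi>) x u))"
    if "\<gamma> \<in> A1 A B (\<lambda>_. UNIV)" for \<gamma>
    using that c \<tau> unfolding A1_def by blast
  show "smooth_map A (fst (U, \<phi>) \<inter> W)
      (\<lambda>x. \<psi> x *v (\<alpha> x (tvec A (U, \<phi>) x u) + \<beta> x (tvec A (U, \<phi>) x u)))"
    using smooth_map_add[OF _ sm[OF assms(1)] sm[OF assms(2)]] chartD(1)[OF c] trivD(1)[OF \<tau>]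
    by (simp add: matrix_vector_right_distrib open_Int)
qed auto

lemma A1_End_apply:
  assumes \<Theta>: "\<Theta> \<in> A1_End A B" and s: "smooth_section UNIV s"
  shows "(\<lambda>x v. \<Theta> x v *v s x) \<in> A1 A B (\<lambda>_. UNIV)"
  unfolding A1_def
proof (intro CollectI conjI ballI allI; (clarify)?)
  fix U \<phi> x assume "(U, \<phi>) \<in> A" "x \<in> fst (U, \<phi>)"
  then have "linear (\<lambda>u. \<Theta> x (tvec A (U, \<phi>) x u))"
    using \<Theta> unfolding A1_End_def by blast
  then show "linear (\<lambda>u. \<Theta> x (tvec A (U, \<phi>) x u) *v s x)"
    by (auto simp: linear_iff matrix_vector_mult_add_rdistrib
        bounded_bilinear.scaleR_left[OF bounded_bilinear_matrix_vector])
next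
  fix U \<phi> W \<psi> u assume c: "(U, \<phi>) \<in> A" and \<tau>: "(W, \<psi>) \<in> B"
  have op: "open (U \<inter> W)" using chartD(1)[OF c] trivD(1)[OF \<tau>] by blast
  have "smooth_map A (U \<inter> W) (\<lambda>x. \<psi> x ** \<Theta> x (tvec A (U, \<phi>) x u) ** matrix_inv (\<psi> x))"
    using \<Theta> c \<tau> unfolding A1_End_def by fastforce
  moreover have "smooth_map A (U \<inter> W) (\<lambda>x. \<psi> x *v s x)"
    using smooth_sectionD[OF s \<tau>] by (rule smooth_map_subset) auto
  ultimately have "smooth_map A (U \<inter> W)
      (\<lambda>x. (\<psi> x ** \<Theta> x (tvec A (U, \<phi>) x u) ** matrix_inv (\<psi> x)) *v (\<psi> x *v s x))"
    using smooth_map_bilinear[OF bounded_bilinear_matrix_vector op] by blast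
  then have "smooth_map A (U \<inter> W) (\<lambda>x. \<psi> x *v (\<Theta> x (tvec A (U, \<phi>) x u) *v s x))"
    by (rule smooth_map_cong[OF op, rotated])
      (simp add: matrix_inv_cancel trivD(2)[OF \<tau>] flip: matrix_vector_mul_assoc)
  then show "smooth_map A (fst (U, \<phi>) \<inter> W)
      (\<lambda>x. \<psi> x *v (\<Theta> x (tvec A (U, \<phi>) x u) *v s x))"
    by simp
qed auto

section \<open>The Cauchy-Riemann operator and the Chern connection\<close>

lemma chern_connectionD:
  assumes "chern_connection A B h D" "smooth_section UNIV s"
  shows "D s \<in> A1 A B (\<lambda>_. UNIV)"
    and "smooth_section UNIV t \<Longrightarrow> v \<in> tangent_space A x \<Longrightarrow>
      D (\<lambda>y. s y + t y) x v = D s x v + D t x v"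
    and "smooth_section UNIV t \<Longrightarrow> v \<in> tangent_space A x \<Longrightarrow>
      v (\<lambda>y. h y (s y) (t y)) = h x (D s x v) (t x) + h x (s x) (D t x v)"
    and "c \<in> A \<Longrightarrow> \<tau> \<in> B \<Longrightarrow> x \<in> fst c \<Longrightarrow> x \<in> fst \<tau> \<Longrightarrow>
      part01 (\<lambda>u. D s x (tvec A c x u)) u = dbar A c \<tau> s x u"
  using assms
  by (simp_all add: chern_connection_def metric_connection_def connection_def A0_UNIV_iff)

lemma holo_section_subset: "holo_section A B V s \<Longrightarrow> N \<subseteq> V \<Longrightarrow> holo_section A B N s"
  unfolding holo_section_def holo_map_def holo_on_def smooth_on_def
  by (fast intro: Ck_on_subset)

lemma dbar_locally_constant:
  assumes "c \<in> A" "x \<in> fst c" "open V" "x \<in> V"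
    and "\<And>y. y \<in> V \<Longrightarrow> \<psi> y *v s y = a"
  shows "dbar A c (W, \<psi>) s x u = 0"
proof -
  have "tvec A c x u (\<lambda>y. (\<psi> y *v s y) $ j) = 0" for u j
    by (rule tvec_locally_constant[OF assms(1-4), of _ "a $ j"]) (simp add: assms(5))
  then show ?thesis
    by (simp add: dbar_def part01_def vec_eq_iff matrix_vector_mult_def)
qed

text \<open>The conclusion tests all charts and trivialisations, hence so does the hypothesis.\<close>

lemma holo_section_if_dbar_zero:
  assumes s: "smooth_section UNIV s" and V: "open V"
    and zero: "\<And>c \<tau> x u. c \<in> A \<Longrightarrow> \<tau> \<in> B \<Longrightarrow> x \<in> V \<Longrightarrow> x \<in> fst c \<Longrightarrow> x \<in> fst \<tau> \<Longrightarrow>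
      dbar A c \<tau> s x u = 0"
  shows "holo_section A B V s"
  unfolding holo_section_def
proof (clarify)
  fix W \<psi> j assume \<tau>: "(W, \<psi>) \<in> B"
  let ?f = "\<lambda>x. (\<psi> x *v s x) $ j"
  have op: "open (V \<inter> W)" using V trivD(1)[OF \<tau>] by blast
  have "smooth_map A (V \<inter> W) (\<lambda>x. \<psi> x *v s x)"
    using smooth_sectionD[OF s \<tau>] by (rule smooth_map_subset) auto
  then have sm: "smooth_map A (V \<inter> W) (\<lambda>x. (\<psi> x *v s x) $ i)" for i
    by (rule smooth_map_bounded_linear[OF bounded_linear_vec_nth op])
  show "holo_map A (V \<inter> W) ?f"
    unfolding holo_map_def holo_on_def
  proof (clarify, intro conjI ballI allI)
    fix U \<phi> assume c: "(U, \<phi>) \<in> A"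
    show "smooth_on (\<phi> ` (U \<inter> (V \<inter> W))) (?f \<circ> inv_into U \<phi>)"
      using sm c unfolding smooth_map_def by blast
    fix z u assume "z \<in> \<phi> ` (U \<inter> (V \<inter> W))"
    then obtain x where x: "z = \<phi> x" "x \<in> U" "x \<in> V" "x \<in> W" by blast
    let ?d = "\<lambda>u. \<chi> i. tvec A (U, \<phi>) x u (\<lambda>y. (\<psi> y *v s y) $ i)"
    have "matrix_inv (\<psi> x) *v part01 ?d u = 0"
      using zero[OF c \<tau> x(3), of u] x by (simp add: dbar_def)
    then have "part01 ?d u = 0"
      using matrix_inv_cancel(1)[OF trivD(2)[OF \<tau> x(4)], of "part01 ?d u"] by simp
    then have "part01 ?d u $ j = 0" by simp
    then have "?d u $ j + \<i> * (?d (\<i> *s u) $ j) = 0"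
      by (simp add: part01_def flip: add_divide_distrib)
    moreover have "?d w $ j = frechet_derivative (?f \<circ> inv_into U \<phi>) (at z) w" for w
      using tvec_eq[OF op _ sm] x by simp
    ultimately have "frechet_derivative (?f \<circ> inv_into U \<phi>) (at z) u =
        - (\<i> * frechet_derivative (?f \<circ> inv_into U \<phi>) (at z) (\<i> *s u))"
      by (simp add: eq_neg_iff_add_eq_0)
    then show "frechet_derivative (?f \<circ> inv_into U \<phi>) (at z) (\<i> *s u) =
        \<i> * frechet_derivative (?f \<circ> inv_into U \<phi>) (at z) u"
      by (simp flip: mult.assoc)
  qed
qed

end

section \<open>The orthogonal complement of a parallel subbundle\<close>

lemma part01_in_subspace:
  assumes "vec.subspace S" "\<And>u. \<alpha> u \<in> S"
  shows "part01 \<alpha> u \<in> S"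
  unfolding part01_def using assms
  by (intro vec.subspace_scale[OF assms(1)] vec.subspace_add[OF assms(1)] assms(2))

lemma invertible_near:
  fixes M :: "'a::topological_space \<Rightarrow> complex^'k^'k"
  assumes "open V" "x \<in> V" "\<And>i j. continuous_on V (\<lambda>y. M y $ i $ j)" "invertible (M x)"
  obtains N where "open N" "x \<in> N" "N \<subseteq> V" "\<And>y. y \<in> N \<Longrightarrow> invertible (M y)"
proof
  have "continuous_on V (\<lambda>y. det (M y))"
    unfolding det_def by (intro continuous_intros assms(3))
  then show "open (V \<inter> (\<lambda>y. det (M y)) -` (- {0}))"
    by (rule continuous_open_preimage[OF _ assms(1)]) auto
qed (use assms in \<open>auto simp: invertible_det_nz\<close>)

context hermitian_subbundle
begin

lemma section_of_F_through:
  assumes "e \<in> F x"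
  obtains s where "s \<in> A0 A B F" "s x = e"
proof -
  obtain V W \<psi> \<sigma> where *: "open V" "x \<in> V" "V \<subseteq> W" "(W, \<psi>) \<in> B"
    "\<And>a. smooth_section UNIV (\<sigma> a)" "\<And>a y. y \<in> V \<Longrightarrow> \<sigma> a y = matrix_inv (\<psi> y) *v a"
    by (rule locally_constant_sections[of x]) blast
  let ?s = "\<sigma> (\<psi> x *v e)"
  have "?s x = e"
    using *(2,3) matrix_inv_cancel(2)[OF trivD(2)[OF *(4)]] by (auto simp: *(6))
  then show ?thesis
    using that[of "\<lambda>y. ?s y - proj y (?s y)"] proj_A0(2)[OF *(5)] proj_zero[OF assms] by simp
qed

text \<open>Since \<open>D\<close> is compatible with the metric, it preserves the complement of \<open>F\<close> if it preserves
  \<open>F\<close>.\<close>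

lemma F_orth_parallel:
  assumes D: "chern_connection A B h D"
    and par: "\<And>s x v. s \<in> A0 A B F \<Longrightarrow> v \<in> tangent_space A x \<Longrightarrow> D s x v \<in> F x"
    and t: "t \<in> A0 A B F_orth" and v: "v \<in> tangent_space A x"
  shows "D t x v \<in> F_orth x"
  unfolding orth_complement_def
proof (intro CollectI ballI)
  fix e assume "e \<in> F x"
  then obtain s where s: "s \<in> A0 A B F" "s x = e" by (rule section_of_F_through)
  have orth: "h y a b = 0" if "a \<in> F y" "b \<in> F_orth y" for a b y
    using that by (simp add: orth_complement_def)
  have "h y (s y) (t y) = 0" for y
    using s(1) t by (intro orth) (auto simp: A0_iff)
  then have "0 = v (\<lambda>y. h y (s y) (t y))"
    using tangent_zero_function[OF v] by simp
  also have "\<dots> = h x (D s x v) (t x) + h x (s x) (D t x v)"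
    using s(1) t v by (intro chern_connectionD(3)[OF D]) (auto simp: A0_iff)
  also have "h x (D s x v) (t x) = 0"
    using par[OF s(1) v] t by (intro orth) (auto simp: A0_iff)
  finally show "h x e (D t x v) = 0" by (simp add: s(2))
qed

text \<open>A parallel splitting is respected by the (0,1)-part of the connection, so the projection maps
  holomorphic sections to holomorphic sections.\<close>

lemma proj_part01_zero:
  assumes D: "chern_connection A B h D"
    and par: "\<And>s x v. s \<in> A0 A B F \<Longrightarrow> v \<in> tangent_space A x \<Longrightarrow> D s x v \<in> F x"
    and s: "smooth_section UNIV s" and c: "c \<in> A" "x \<in> fst c"
    and zero: "part01 (\<lambda>u. D s x (tvec A c x u)) u = 0"
  shows "part01 (\<lambda>u. D (\<lambda>y. proj y (s y)) x (tvec A c x u)) u = 0"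
proof -
  let ?p = "\<lambda>y. proj y (s y)" and ?q = "\<lambda>y. s y - proj y (s y)"
  let ?part = "\<lambda>s. part01 (\<lambda>u. D s x (tvec A c x u)) u"
  have sm: "smooth_section UNIV ?p" "smooth_section UNIV ?q"
    using proj_A0[OF s] by (auto simp: A0_iff)
  have "D s x (tvec A c x u) = D ?p x (tvec A c x u) + D ?q x (tvec A c x u)" for u
    using chern_connectionD(2)[OF D sm tvec_in_tangent_space[OF c]] by simp
  then have "?part ?p + ?part ?q = 0"
    using zero by (simp add: part01_def algebra_simps vector_add_ldistrib)
  then have eq: "?part ?p = - ?part ?q"
    by (simp only: eq_neg_iff_add_eq_0)
  have "?part ?q \<in> F x"
    by (intro part01_in_subspace subspace_F par proj_A0 s tvec_in_tangent_space c)
  then have "?part ?p \<in> F x"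
    unfolding eq by (rule vec.subspace_neg[OF subspace_F])
  moreover have "?part ?p \<in> F_orth x"
    by (intro part01_in_subspace subspace_orth F_orth_parallel[OF D par] proj_A0 s
        tvec_in_tangent_space c)
  ultimately show ?thesis by (rule F_Int_orth)
qed

text \<open>The complement of a parallel subbundle is holomorphic. Near \<open>x\<close>, let \<open>L\<^sub>y\<close> be the identification
  of \<open>E\<^sub>x\<close> with \<open>E\<^sub>y\<close> in a holomorphic trivialisation. The endomorphism \<open>T y\<close> below applies \<open>L\<^sub>y\<close> to
  the two components of a vector of \<open>E\<^sub>x\<close> and projects the results to the corresponding summands of
  \<open>E\<^sub>y\<close>. It respects the splittings and is the identity at \<open>x\<close>, so it stays invertible near \<open>x\<close>
  and carries a basis of the complement at \<open>x\<close> to a frame; this frame is holomorphic by the lemma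
  above.\<close>

theorem holomorphic_orth_complement:
  assumes D: "chern_connection A B h D"
    and par: "\<And>s x v. s \<in> A0 A B F \<Longrightarrow> v \<in> tangent_space A x \<Longrightarrow> D s x v \<in> F x"
  shows "holomorphic_subbundle A B F_orth"
  unfolding holomorphic_subbundle_def
proof
  fix x
  obtain V W \<psi> \<sigma> where V: "open V" "x \<in> V" "V \<subseteq> W" and \<tau>: "(W, \<psi>) \<in> B"
    and \<sigma>: "\<And>a. smooth_section UNIV (\<sigma> a)" "\<And>a y. y \<in> V \<Longrightarrow> \<sigma> a y = matrix_inv (\<psi> y) *v a"
    by (rule locally_constant_sections[of x]) blast
  have inv: "invertible (\<psi> y)" if "y \<in> V" for y
    using trivD(2)[OF \<tau>] V(3) that by blast
  have holo: "holo_section A B V (\<lambda>y. proj y (\<sigma> a y))" for a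
  proof (rule holo_section_if_dbar_zero[OF _ V(1)])
    show p: "smooth_section UNIV (\<lambda>y. proj y (\<sigma> a y))"
      by (rule smooth_section_proj[OF \<sigma>(1)])
    fix c \<tau>' y u
    assume *: "c \<in> A" "\<tau>' \<in> B" "y \<in> V" "y \<in> fst c" "y \<in> fst \<tau>'"
    \<comment> \<open>The (0,1)-part of the connection does not depend on the trivialisation: it is computed in \<open>\<psi>\<close>,
      where the section is constant, and then read off in \<open>\<tau>'\<close>.\<close>
    have "dbar A c (W, \<psi>) (\<sigma> a) y u = 0"
      by (rule dbar_locally_constant[OF *(1,4) V(1) *(3), of _ _ a])
        (simp add: \<sigma>(2) matrix_inv_cancel(1)[OF inv])
    then have "part01 (\<lambda>u. D (\<sigma> a) y (tvec A c y u)) u = 0"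
      using chern_connectionD(4)[OF D \<sigma>(1) *(1) \<tau> *(4)] *(3) V(3) by auto
    then have "part01 (\<lambda>u. D (\<lambda>y. proj y (\<sigma> a y)) y (tvec A c y u)) u = 0"
      by (intro proj_part01_zero[OF D _ \<sigma>(1) *(1,4)] par)
    then show "dbar A c \<tau>' (\<lambda>y. proj y (\<sigma> a y)) y u = 0"
      using chern_connectionD(4)[OF D p *(1,2,4,5)] by simp
  qed
  define T where "T y e = proj y (\<sigma> (\<psi> x *v proj x e) y) +
    (\<sigma> (\<psi> x *v (e - proj x e)) y - proj y (\<sigma> (\<psi> x *v (e - proj x e)) y))" for y e
  have proj_x [simp]: "proj x (proj x e) = proj x e" "proj x (e - proj x e) = 0" for e
    using proj_id[OF proj_orth] proj_zero[OF diff_proj] by auto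
  have Tx: "T x e = e" for e
    by (simp add: T_def \<sigma>(2)[OF V(2)] matrix_inv_cancel(2)[OF inv[OF V(2)]])
  have Tlin: "Vector_Spaces.linear (*s) (*s) (T y)" if y: "y \<in> V" for y
  proof -
    have "T y (e + e') = T y e + T y e'" for e e'
      by (simp add: T_def \<sigma>(2)[OF y] proj_add matrix_vector_right_distrib
          matrix_vector_mult_diff_distrib proj_diff)
    moreover have "T y (a *s e) = a *s T y e" for a e
      by (simp only: T_def \<sigma>(2)[OF y] proj_smult vector_scalar_commute vector_add_ldistrib
          vector_ssub_ldistrib proj_diff matrix_vector_mult_diff_distrib)
    ultimately show ?thesis
      by (simp add: Vector_Spaces.linear_iff vec.vector_space_axioms)
  qed
  define M where "M y = matrix (\<lambda>e. \<psi> y *v T y e)" for y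
  have M: "M y *v e = \<psi> y *v T y e" if "y \<in> V" for y e
  proof -
    have "Vector_Spaces.linear (*s) (*s) (\<lambda>e. \<psi> y *v T y e)"
      using Vector_Spaces.linear_compose[OF Tlin[OF that] matrix_vector_mul_linear_gen, of "\<psi> y"]
      by (simp add: o_def)
    then show ?thesis
      unfolding M_def by (rule matrix_works)
  qed
  have cont: "continuous_on V (\<lambda>y. M y $ i $ j)" for i j
  proof -
    let ?t = "\<lambda>y. T y (axis j 1)"
    have "smooth_section UNIV ?t"
      unfolding T_def
      by (intro smooth_section_add smooth_section_diff smooth_section_proj \<sigma> open_UNIV)
    then have "smooth_map A W (\<lambda>y. \<psi> y *v ?t y)"
      using smooth_sectionD[OF _ \<tau>] by fastforce
    then have "continuous_on V (\<lambda>y. \<psi> y *v ?t y)"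
      using smooth_map_continuous_on trivD(1)[OF \<tau>] V(3) continuous_on_subset by blast
    then show ?thesis
      unfolding M_def matrix_def by (auto intro: continuous_on_component)
  qed
  have "M x = \<psi> x"
    by (simp add: M_def Tx)
  then have "invertible (M x)" using inv V(2) by simp
  then obtain N where N: "open N" "x \<in> N" "N \<subseteq> V" "\<And>y. y \<in> N \<Longrightarrow> invertible (M y)"
    using invertible_near[OF V(1,2) cont] by blast
  obtain S where S: "S \<subseteq> F_orth x" "vec.independent S" "F_orth x \<subseteq> vec.span S"
    by (rule vec.basis_exists)
  have spanS: "vec.span S = F_orth x"
    using S subspace_orth by (simp add: vec.span_subspace)
  obtain a where a: "bij_betw a {..<card S} S"
    using ex_bij_betw_nat_finite[OF vec.finiteI_independent[OF S(2)]] by (auto simp: atLeast0LessThan)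
  let ?e = "\<lambda>i y. proj y (\<sigma> (\<psi> x *v a i) y)"
  have T_orth: "T y e = proj y (\<sigma> (\<psi> x *v e) y)" if "y \<in> V" "e \<in> F_orth x" for y e
    using that by (simp add: T_def proj_id \<sigma>(2) proj_zero vec.subspace_0[OF subspace_F])
  show "\<exists>U k e. open U \<and> x \<in> U \<and> (\<forall>i<(k::nat). holo_section A B U (e i)) \<and>
      (\<forall>y\<in>U. inj_on (\<lambda>i. e i y) {..<k} \<and> vec.independent ((\<lambda>i. e i y) ` {..<k}) \<and>
        vec.span ((\<lambda>i. e i y) ` {..<k}) = F_orth y)"
  proof (intro exI[of _ N] exI[of _ "card S"] exI[of _ ?e] conjI ballI allI impI N)
    fix i
    show "holo_section A B N (?e i)"
      using holo_section_subset[OF holo N(3)] .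
  next
    fix y assume y: "y \<in> N"
    then have yV: "y \<in> V" using N(3) by blast
    have e_eq: "?e i y = T y (a i)" if "i < card S" for i
    proof -
      have "a i \<in> S" using bij_betwE[OF a] that by blast
      then show ?thesis using T_orth[OF yV] S(1) by auto
    qed
    have "(\<lambda>i. ?e i y) ` {..<card S} = T y ` a ` {..<card S}"
      unfolding image_image by (rule image_cong) (auto simp: e_eq)
    then have img: "(\<lambda>i. ?e i y) ` {..<card S} = T y ` S"
      by (simp only: bij_betw_imp_surj_on[OF a])
    interpret Ty: Vector_Spaces.linear "(*s)" "(*s)" "T y"
      by (rule Tlin[OF yV])
    have inj: "inj (T y)"
    proof (rule injI)
      fix e e' assume "T y e = T y e'"
      then have "M y *v e = M y *v e'" by (simp add: M[OF yV])
      then show "e = e'" using matrix_inv_cancel(2)[OF N(4)[OF y]] by metis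
    qed
    have surj: "\<exists>e. T y e = w" for w
    proof -
      have "\<psi> y *v T y (matrix_inv (M y) *v (\<psi> y *v w)) = \<psi> y *v w"
        by (simp add: matrix_inv_cancel(1)[OF N(4)[OF y]] flip: M[OF yV])
      then show ?thesis using matrix_inv_cancel(2)[OF inv[OF yV]] by metis
    qed
    show "inj_on (\<lambda>i. ?e i y) {..<card S}"
      using a inj by (auto simp: inj_on_def e_eq bij_betw_def)
    show "vec.independent ((\<lambda>i. ?e i y) ` {..<card S})"
      unfolding img using S(2) inj_on_subset[OF inj]
      by (intro Ty.independent_injective_image) auto
    have "T y ` F_orth x = F_orth y"
    proof
      show "T y ` F_orth x \<subseteq> F_orth y"
        using T_orth[OF yV] proj_orth by auto
      show "F_orth y \<subseteq> T y ` F_orth x"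
      proof
        fix w assume w: "w \<in> F_orth y"
        obtain e where e: "T y e = w" using surj by blast
        have "w = proj y (T y e)" using e proj_id[OF w] by simp
        also have "\<dots> = proj y (\<sigma> (\<psi> x *v proj x e) y)"
          by (simp add: T_def proj_add proj_id[OF proj_orth] proj_zero[OF diff_proj])
        also have "\<dots> = T y (proj x e)" by (simp add: T_orth[OF yV] proj_orth)
        finally show "w \<in> T y ` F_orth x" using proj_orth by blast
      qed
    qed
    then show "vec.span ((\<lambda>i. ?e i y) ` {..<card S}) = F_orth y"
      unfolding img Ty.span_image spanS .
  qed
qed

end


theorem corollary2:
  fixes A :: "('m::t2_space, 'n::finite) chart set" and \<omega> :: "'m form2"
    and B :: "('m, 'r::finite) triv set" and \<Phi> \<Phi>b :: "('m, 'r) end_form"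
    and h :: "('m, 'r) herm" and D \<D> :: "('m, 'r) conn"
    and E' E'' :: "'m \<Rightarrow> (complex^'r) set"
  assumes "compact_kaehler_manifold A \<omega>"
    and "hermitian_higgs_bundle A B \<Phi> h"
    and "chern_connection A B h D"
    and "hermitian_conjugate A B h \<Phi> \<Phi>b"
    and "\<D> = hitchin_simpson D \<Phi> \<Phi>b"
    and "higgs_subbundle A B \<Phi> E'"
    and "connection_invariant A B \<D> E'"
    and "form_invariant A \<Phi>b E'"
    and "E'' = orth_complement h E'"
  shows "higgs_subbundle A B \<Phi> E'' \<and> connection_invariant A B \<D> E'' \<and>
    higgs_orthogonal_decomposition A B \<Phi> h E' E''"
proof -
  interpret hermitian_subbundle A B h E'
    using assms(1,2,6)
    by unfold_locales (auto simp: compact_kaehler_manifold_def hermitian_higgs_bundle_def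
        higgs_bundle_def higgs_subbundle_def)
  note D = assms(3) and E'' = assms(9)
  have \<Phi>_inv: "\<Phi> x v *v e \<in> E' x" if "v \<in> tangent_space A x" "e \<in> E' x" for x v e
    using assms(6) that unfolding higgs_subbundle_def form_invariant_def by blast
  have \<Phi>b_inv: "\<Phi>b x v *v e \<in> E' x" if "v \<in> tangent_space A x" "e \<in> E' x" for x v e
    using assms(8) that unfolding form_invariant_def by blast
  have adj: "h x (\<Phi>b x v *v e) e' = h x e (\<Phi> x v *v e')"
    if "v \<in> tangent_space A x" for x v e e'
    using assms(4) that unfolding hermitian_conjugate_def by blast
  have par: "D s x v \<in> E' x" if s: "s \<in> A0 A B E'" and v: "v \<in> tangent_space A x" for s x v
  proof -
    have "\<D> s x v \<in> E' x"
      using assms(7) s v unfolding connection_invariant_def A1_def by blast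
    then have "D s x v + \<Phi> x v *v s x + \<Phi>b x v *v s x \<in> E' x"
      by (simp add: assms(5) hitchin_simpson_def)
    moreover have "s x \<in> E' x" using s by (simp add: A0_iff)
    ultimately have "D s x v + \<Phi> x v *v s x + \<Phi>b x v *v s x - \<Phi>b x v *v s x - \<Phi> x v *v s x \<in> E' x"
      by (intro vec.subspace_diff[OF subspace_F] \<Phi>_inv \<Phi>b_inv v)
    then show ?thesis by simp
  qed
  have \<Phi>_inv'': "\<Phi> x v *v w \<in> E'' x" if v: "v \<in> tangent_space A x" and w: "w \<in> E'' x" for x v w
    unfolding E'' orth_complement_def
  proof (intro CollectI ballI)
    fix e assume "e \<in> E' x"
    then have "h x (\<Phi>b x v *v e) w = 0"
      using \<Phi>b_inv[OF v] w by (simp add: E'' orth_complement_def)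
    then show "h x e (\<Phi> x v *v w) = 0" by (simp add: adj[OF v])
  qed
  have \<Phi>b_inv'': "\<Phi>b x v *v w \<in> E'' x" if v: "v \<in> tangent_space A x" and w: "w \<in> E'' x" for x v w
    unfolding E'' orth_complement_def
  proof (intro CollectI ballI)
    fix e assume "e \<in> E' x"
    then have "h x (\<Phi> x v *v e) w = 0"
      using \<Phi>_inv[OF v] w by (simp add: E'' orth_complement_def)
    then have "h x w (\<Phi> x v *v e) = 0"
      by (subst h_cnj) simp
    then show "h x e (\<Phi>b x v *v w) = 0"
      by (subst h_cnj) (simp add: adj[OF v])
  qed
  have sub: "holomorphic_subbundle A B E''"
    unfolding E'' by (rule holomorphic_orth_complement[OF D]) (rule par)
  then have higgs: "higgs_subbundle A B \<Phi> E''"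
    using \<Phi>_inv'' by (simp add: higgs_subbundle_def form_invariant_def)
  have "\<D> s \<in> A1 A B E''" if s: "s \<in> A0 A B E''" for s
  proof -
    have sm: "smooth_section UNIV s" and sE: "s x \<in> E'' x" for x
      using s by (auto simp: A0_iff)
    have end_forms: "\<Phi> \<in> A1_End A B" "\<Phi>b \<in> A1_End A B"
      using assms(2,4) by (auto simp: hermitian_higgs_bundle_def higgs_bundle_def
          holomorphic_End_form_def A10_End_def hermitian_conjugate_def A01_End_def)
    have "\<D> s \<in> A1 A B (\<lambda>_. UNIV)"
      unfolding assms(5) hitchin_simpson_def
      by (intro A1_add chern_connectionD(1)[OF D sm] A1_End_apply end_forms sm)
    moreover have "\<D> s x v \<in> E'' x" if v: "v \<in> tangent_space A x" for x v
    proof -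
      have "D s x v \<in> E'' x"
        using F_orth_parallel[OF D par] s v unfolding E'' by blast
      then show ?thesis
        unfolding assms(5) hitchin_simpson_def
        using \<Phi>_inv''[OF v sE] \<Phi>b_inv''[OF v sE] subspace_orth[of x]
        by (simp add: E'' vec.subspace_add)
    qed
    ultimately show ?thesis by (simp add: A1_def)
  qed
  then have conn: "connection_invariant A B \<D> E''"
    by (simp add: connection_invariant_def)
  have "\<exists>!p. p \<in> E' x \<times> E'' x \<and> e = fst p + snd p" for x e
  proof (rule ex1I[of _ "(e - proj x e, proj x e)"])
    show "(e - proj x e, proj x e) \<in> E' x \<times> E'' x \<and>
        e = fst (e - proj x e, proj x e) + snd (e - proj x e, proj x e)"
      by (simp add: E'' proj_orth diff_proj)
  next
    fix p assume p: "p \<in> E' x \<times> E'' x \<and> e = fst p + snd p"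
    then have "proj x e = snd p"
      by (intro proj_eqI) (auto simp: E'')
    then show "p = (e - proj x e, proj x e)"
      using p by (auto simp: prod_eq_iff)
  qed
  then have "holomorphic_direct_sum A B E' E''"
    using subbundle sub by (simp add: holomorphic_direct_sum_def)
  then have "higgs_orthogonal_decomposition A B \<Phi> h E' E''"
    using assms(6) higgs by (simp add: higgs_orthogonal_decomposition_def E'' orth_complement_def)
  with higgs conn show ?thesis by blast
qed

end
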